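(* For any recursive infinite minimal subshift $Y$ (over a finite alphabet, with $\mathbb{Z}$-action), there exists a transitive uncountable quasiminimal subshift $X$ for which the halting problem along a clopen set is $\Sigma^0_1$-complete, and such that the only nontrivial subsystem of $X$ is $Y$.
   Context: For a finite alphabet $S$, give $S^{\mathbb{Z}}$ the product topology and the shift $\sigma(x)_i = x_{i+1}$. A subshift is a closed set $X \subset S^{\mathbb{Z}}$ with $\sigma(X)=X$; a subsystem of $X$ is a subshift $Y \subset X$, and it is nontrivial if it is nonempty and different from $X$. A subshift is minimal if its only subshifts are $\emptyset$ and itself; it is quasiminimal if it has finitely many proper subshifts. The language $\mathcal{L}(X)$ is the set of finite words occurring as contiguous subwords of points of $X$; $X$ is recursive if $\mathcal{L}(X)$ is recursive. $X$ is transitive if it contains a point $x$ such that every word of $\mathcal{L}(X)$ occurs infinitely many times in both the left and the right tail of $x$. For a finite set $C$ of words of a common length $n$, $[C]$ is the clopen set of points $x$ with $x_{[0,n-1]} \in C$; clopen sets are given in such a finite form (up to a shift of coordinates). The halting problem along a clopen set for $X$ is: given clopen sets $[C],[D],[E]$, decide whether there exist $x \in X$ and $j \in \mathbb{N}=\{0,1,2,\dots\}$ with $x \in [C]$, $\sigma^j(x) \in [D]$ and $\sigma^i(x) \in [E]$ for all $i \in [1,j-1]$. Completeness is under many-one reductions. *)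

theory Defs
  imports "HOL-Analysis.Analysis" "HOL-Library.Nat_Bijection"
begin

text \<open>
  Kleene's \<open>\<mu>\<close>-recursive functions. Terms carry no arity: for each \<open>k\<close>, a term denotes a
  \<open>k\<close>-ary partial function, which is undefined wherever the arities do not fit.
\<close>

datatype recf =
    Zero
  | Succ
  | Proj nat
  | Comp recf "recf list"
  | PrimRec recf recf
  | Mu recf

inductive computes :: "recf \<Rightarrow> nat list \<Rightarrow> nat \<Rightarrow> bool" where
  zero: "computes Zero xs 0"
| succ: "computes Succ [x] (Suc x)"
| proj: "i < length xs \<Longrightarrow> computes (Proj i) xs (xs ! i)"
| comp: "list_all2 (\<lambda>g y. computes g xs y) gs ys \<Longrightarrow> computes f ys z
    \<Longrightarrow> computes (Comp f gs) xs z"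
| primrec_zero: "computes f xs y \<Longrightarrow> computes (PrimRec f g) (0 # xs) y"
| primrec_Suc: "computes (PrimRec f g) (n # xs) y \<Longrightarrow> computes g (n # y # xs) z
    \<Longrightarrow> computes (PrimRec f g) (Suc n # xs) z"
| mu: "computes f (n # xs) 0 \<Longrightarrow> \<forall>m<n. \<exists>y. computes f (m # xs) (Suc y)
    \<Longrightarrow> computes (Mu f) xs n"

lemma computes_deterministic:
  assumes "computes f xs y" and "computes f xs y'"
  shows "y = y'"
  using assms
proof (induction arbitrary: y' rule: computes.induct)
  case (zero xs)
  then show ?case by (auto elim: computes.cases)
next
  case (succ x)
  then show ?case by (auto elim: computes.cases)
next
  case (proj i xs)
  from proj.prems show ?case by (cases) auto
next
  case (comp xs gs ys f z)
  from comp.prems obtain ys'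
    where ys': "list_all2 (\<lambda>g y. computes g xs y) gs ys'" and f: "computes f ys' y'"
    by cases auto
  have "ys = ys'"
    using comp.IH(1) ys' by (auto simp: list_all2_conv_all_nth intro!: nth_equalityI)
  with f comp.IH(2) show ?case by blast
next
  case (primrec_zero f xs y g)
  from primrec_zero.prems show ?case by cases (auto intro: primrec_zero.IH)
next
  case (primrec_Suc f g n xs y z)
  from primrec_Suc.prems obtain v
    where "computes (PrimRec f g) (n # xs) v" and "computes g (n # v # xs) y'"
    by cases auto
  then show ?case using primrec_Suc.IH by blast
next
  case (mu f n xs)
  from mu.prems have 1: "computes f (y' # xs) 0"
    and 2: "\<forall>m<y'. \<exists>y. computes f (m # xs) (Suc y)"
    by (cases, auto)+
  have "\<not> y' < n" using mu.IH(2) 1 by blast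
  moreover have "\<not> n < y'" using mu.IH(1) 2 by blast
  ultimately show ?case by simp
qed

definition recursive_fun :: "(nat \<Rightarrow> nat) \<Rightarrow> bool" where
  "recursive_fun f \<longleftrightarrow> (\<exists>p. \<forall>n. computes p [n] (f n))"

definition recursive_set :: "nat set \<Rightarrow> bool" where
  "recursive_set A \<longleftrightarrow> recursive_fun (\<lambda>n. if n \<in> A then 1 else 0)"

definition recursive_rel :: "(nat \<Rightarrow> nat \<Rightarrow> bool) \<Rightarrow> bool" where
  "recursive_rel R \<longleftrightarrow> (\<exists>p. \<forall>m n. computes p [m, n] (if R m n then 1 else 0))"

definition Sigma1 :: "nat set \<Rightarrow> bool" where
  "Sigma1 A \<longleftrightarrow> (\<exists>R. recursive_rel R \<and> A = {n. \<exists>m. R n m})"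

definition many_one_reducible :: "nat set \<Rightarrow> nat set \<Rightarrow> bool" where
  "many_one_reducible A B \<longleftrightarrow> (\<exists>f. recursive_fun f \<and> (\<forall>n. n \<in> A \<longleftrightarrow> f n \<in> B))"

definition Sigma1_complete :: "nat set \<Rightarrow> bool" where
  "Sigma1_complete B \<longleftrightarrow> Sigma1 B \<and> (\<forall>A. Sigma1 A \<longrightarrow> many_one_reducible A B)"

definition shift_map :: "(int \<Rightarrow> 'a) \<Rightarrow> int \<Rightarrow> 'a" where
  "shift_map x = (\<lambda>i. x (i + 1))"

definition full_shift :: "'a set \<Rightarrow> (int \<Rightarrow> 'a) topology" where
  "full_shift S = product_topology (\<lambda>_. discrete_topology S) UNIV"

definition subshift :: "'a set \<Rightarrow> (int \<Rightarrow> 'a) set \<Rightarrow> bool" where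
  "subshift S X \<longleftrightarrow> finite S \<and> closedin (full_shift S) X \<and> shift_map ` X = X"

definition subsystem :: "'a set \<Rightarrow> (int \<Rightarrow> 'a) set \<Rightarrow> (int \<Rightarrow> 'a) set \<Rightarrow> bool" where
  "subsystem S Z X \<longleftrightarrow> subshift S Z \<and> Z \<subseteq> X"

definition nontrivial_subsystem :: "'a set \<Rightarrow> (int \<Rightarrow> 'a) set \<Rightarrow> (int \<Rightarrow> 'a) set \<Rightarrow> bool" where
  "nontrivial_subsystem S Z X \<longleftrightarrow> subsystem S Z X \<and> Z \<noteq> {} \<and> Z \<noteq> X"

definition minimal_subshift :: "'a set \<Rightarrow> (int \<Rightarrow> 'a) set \<Rightarrow> bool" where
  "minimal_subshift S X \<longleftrightarrow> subshift S X \<and> (\<forall>Z. subsystem S Z X \<longrightarrow> Z = {} \<or> Z = X)"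

definition quasiminimal_subshift :: "'a set \<Rightarrow> (int \<Rightarrow> 'a) set \<Rightarrow> bool" where
  "quasiminimal_subshift S X \<longleftrightarrow> subshift S X \<and> finite {Z. subsystem S Z X \<and> Z \<noteq> X}"

definition window :: "(int \<Rightarrow> 'a) \<Rightarrow> int \<Rightarrow> nat \<Rightarrow> 'a list" where
  "window x k n = map (\<lambda>i. x (k + int i)) [0..<n]"

definition language :: "(int \<Rightarrow> 'a) set \<Rightarrow> 'a list set" where
  "language X = {window x k n |x k n. x \<in> X}"

definition transitive_subshift :: "'a set \<Rightarrow> (int \<Rightarrow> 'a) set \<Rightarrow> bool" where
  "transitive_subshift S X \<longleftrightarrow> subshift S X \<and>
    (\<exists>x\<in>X. \<forall>w\<in>language X.
      infinite {k. k < 0 \<and> window x k (length w) = w} \<and>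
      infinite {k. k \<ge> 0 \<and> window x k (length w) = w})"

text \<open>
  For computability, letters are natural numbers and words are coded by \<^const>\<open>list_encode\<close>.
\<close>

definition recursive_subshift :: "nat set \<Rightarrow> (int \<Rightarrow> nat) set \<Rightarrow> bool" where
  "recursive_subshift S X \<longleftrightarrow> subshift S X \<and> recursive_set (list_encode ` language X)"

text \<open>
  \<open>(k, n, ws)\<close> presents the clopen set \<open>{x. x\<^bsub>[k, k + n - 1]\<^esub> \<in> C}\<close>, where the finite set \<open>C\<close> of words
  of length \<open>n\<close> is listed as \<open>ws\<close>. For \<open>k = 0\<close> this is \<open>[C]\<close>; the offset \<open>k\<close> is the shift of
  coordinates needed to present every clopen set.
\<close>

type_synonym 'a clopen_pres = "int \<times> nat \<times> 'a list list"

definition valid_pres :: "'a set \<Rightarrow> 'a clopen_pres \<Rightarrow> bool" where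
  "valid_pres S = (\<lambda>(k, n, ws). \<forall>w\<in>set ws. w \<in> lists S \<and> length w = n)"

definition clopen_of :: "'a clopen_pres \<Rightarrow> (int \<Rightarrow> 'a) set" where
  "clopen_of = (\<lambda>(k, n, ws). {x. window x k n \<in> set ws})"

definition pres_encode :: "nat clopen_pres \<Rightarrow> nat" where
  "pres_encode = (\<lambda>(k, n, ws).
    prod_encode (int_encode k, prod_encode (n, list_encode (map list_encode ws))))"

definition halts_along ::
  "(int \<Rightarrow> 'a) set \<Rightarrow> (int \<Rightarrow> 'a) set \<Rightarrow> (int \<Rightarrow> 'a) set \<Rightarrow> (int \<Rightarrow> 'a) set \<Rightarrow> bool" where
  "halts_along X C D E \<longleftrightarrow> (\<exists>x\<in>X. \<exists>j::nat.
    x \<in> C \<and> (shift_map ^^ j) x \<in> D \<and> (\<forall>i. 1 \<le> i \<and> i < j \<longrightarrow> (shift_map ^^ i) x \<in> E))"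

definition halting_problem :: "nat set \<Rightarrow> (int \<Rightarrow> nat) set \<Rightarrow> nat set" where
  "halting_problem S X =
    {prod_encode (pres_encode c, prod_encode (pres_encode d, pres_encode e)) |c d e.
      valid_pres S c \<and> valid_pres S d \<and> valid_pres S e \<and>
      halts_along X (clopen_of c) (clopen_of d) (clopen_of e)}"

end

theory Submission
  imports Defs "HOL-Library.Sublist"
begin

text \<open>
  Take a letter \<open>h\<close> outside the alphabet of \<open>Y\<close> and words \<open>u 0, u 1, \<dots>\<close> of the language of \<open>Y\<close>, of
  unbounded length. Put \<open>T 0 = h\<close> and \<open>T (n + 1) = T n \<cdot> u n \<cdot> T n \<cdot> u n \<cdot> T n\<close>, and let \<open>X\<close> consist of
  the points all of whose windows occur in some \<open>T n\<close>.
  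
  The dynamical claims hold for every choice of the gap words \<open>u n\<close> (locale \<open>word_tower\<close>). An
  occurrence of \<open>h\<close> in \<open>T m\<close> lies inside an occurrence of \<open>T n\<close> whenever \<open>n \<le> m\<close>. Hence a point of \<open>X\<close>
  that contains \<open>h\<close> contains every \<open>T n\<close> and has a dense orbit (\<open>dense_orbit\<close>). A point of \<open>X\<close> that
  avoids \<open>h\<close> has all its windows inside gaps, so it belongs to \<open>Y\<close>; such points exist by compactness,
  because the gaps get arbitrarily long, and by minimality they make up all of \<open>Y\<close> (\<open>Y_eq\<close>). So the
  subsystems of \<open>X\<close> are the empty one, \<open>Y\<close> and \<open>X\<close>. The words \<open>T n\<close>, centred at the origin, converge
  to a point in which every word recurs on both sides. This point is not periodic, so two occurrences
  of a word give distinct points sharing that word: \<open>X\<close> has no isolated point and is uncountable.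
  
  The lengths of the gaps are free, and they carry the computational content. Let
  \<open>{e. \<exists>w. R e w}\<close> be a universal recursively enumerable set with \<open>R\<close> recursive. The gap at stage
  \<open>n = (e, w)\<close> has length \<open>2 * e + 1\<close> if \<open>R e w\<close> holds and the even length \<open>2 * n\<close> otherwise, and it is
  filled with the least word of \<open>Y\<close> of that length, which is computable as the language of \<open>Y\<close> is
  recursive. If \<open>v\<close> is the least word of length \<open>2 * e + 1\<close>, then \<open>h v h\<close> occurs in \<open>X\<close> if and only if
  \<open>e\<close> is in the universal set. Whether a word occurs is an instance of the halting problem with \<open>j = 0\<close>,
  so the problem is \<open>\<Sigma>\<^sub>1\<close>-hard. It is \<open>\<Sigma>\<^sub>1\<close> because a halting orbit segment involves finitely
  many coordinates and is therefore visible inside some \<open>T N\<close>, and the sequence \<open>T\<close> is computable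
  (\<open>halts_along_tower_iff\<close>).
  
  The universal set comes from derivations in the calculus that defines \<^const>\<open>computes\<close>, coded as
  numbers: checking a derivation only needs bounded quantifiers.
\<close>

section \<open>Recursive functions\<close>

text \<open>
  Recursiveness is mostly proved for unary functions, in which a tuple is passed as one number through
  Cantor's pairing: a proof then follows the shape of the term. Functions of several arguments are
  needed only until pairing and its inverse are known to be recursive.
\<close>

definition recursive_arity :: "nat \<Rightarrow> (nat list \<Rightarrow> nat) \<Rightarrow> bool" where
  "recursive_arity k f \<longleftrightarrow> (\<exists>p. \<forall>xs. length xs = k \<longrightarrow> computes p xs (f xs))"

lemma recursive_arity_nth: "i < k \<Longrightarrow> recursive_arity k (\<lambda>xs. xs ! i)"
  unfolding recursive_arity_def by (blast intro: computes.proj)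

lemma recursive_arity_comp1:
  assumes "recursive_arity 1 f" "recursive_arity k a"
  shows "recursive_arity k (\<lambda>xs. f [a xs])"
proof -
  obtain p where p: "\<And>xs. length xs = 1 \<Longrightarrow> computes p xs (f xs)" using assms(1) by (auto simp: recursive_arity_def)
  obtain q where q: "\<And>xs. length xs = k \<Longrightarrow> computes q xs (a xs)" using assms(2) by (auto simp: recursive_arity_def)
  have "computes (Comp p [q]) xs (f [a xs])" if "length xs = k" for xs
    by (rule computes.comp[where ys = "[a xs]"]) (use p q that in auto)
  then show ?thesis unfolding recursive_arity_def by blast
qed

lemma recursive_arity_comp2:
  assumes "recursive_arity 2 f" "recursive_arity k a" "recursive_arity k b"
  shows "recursive_arity k (\<lambda>xs. f [a xs, b xs])"
proof -
  obtain p where p: "\<And>xs. length xs = 2 \<Longrightarrow> computes p xs (f xs)" using assms(1) by (auto simp: recursive_arity_def)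
  obtain q where q: "\<And>xs. length xs = k \<Longrightarrow> computes q xs (a xs)" using assms(2) by (auto simp: recursive_arity_def)
  obtain r where r: "\<And>xs. length xs = k \<Longrightarrow> computes r xs (b xs)" using assms(3) by (auto simp: recursive_arity_def)
  have "computes (Comp p [q, r]) xs (f [a xs, b xs])" if "length xs = k" for xs
    by (rule computes.comp[where ys = "[a xs, b xs]"]) (use p q r that in auto)
  then show ?thesis unfolding recursive_arity_def by blast
qed

lemma recursive_arity_Suc:
  assumes "recursive_arity k a"
  shows "recursive_arity k (\<lambda>xs. Suc (a xs))"
proof -
  obtain q where q: "\<And>xs. length xs = k \<Longrightarrow> computes q xs (a xs)" using assms by (auto simp: recursive_arity_def)
  have "computes (Comp Succ [q]) xs (Suc (a xs))" if "length xs = k" for xs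
    by (rule computes.comp[where ys = "[a xs]"]) (use q that in \<open>auto intro: computes.succ\<close>)
  then show ?thesis unfolding recursive_arity_def by blast
qed

lemma recursive_arity_const: "recursive_arity k (\<lambda>_. c)"
proof (induction c)
  case 0
  then show ?case unfolding recursive_arity_def by (blast intro: computes.zero)
next
  case (Suc c)
  then show ?case by (rule recursive_arity_Suc)
qed

lemma recursive_arity_rec:
  assumes "recursive_arity k f" "recursive_arity (Suc (Suc k)) g"
  shows "recursive_arity (Suc k) (\<lambda>xs. rec_nat (f (tl xs)) (\<lambda>n y. g (n # y # tl xs)) (hd xs))"
proof -
  obtain p where p: "\<And>xs. length xs = k \<Longrightarrow> computes p xs (f xs)" using assms(1) by (auto simp: recursive_arity_def)
  obtain q where q: "\<And>xs. length xs = Suc (Suc k) \<Longrightarrow> computes q xs (g xs)" using assms(2) by (auto simp: recursive_arity_def)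
  have "computes (PrimRec p q) (n # xs) (rec_nat (f xs) (\<lambda>n y. g (n # y # xs)) n)"
    if "length xs = k" for n xs
    by (induction n) (use p q that in \<open>auto intro: computes.primrec_zero computes.primrec_Suc\<close>)
  then have "computes (PrimRec p q) xs (rec_nat (f (tl xs)) (\<lambda>n y. g (n # y # tl xs)) (hd xs))"
    if "length xs = Suc k" for xs
    using that by (cases xs) auto
  then show ?thesis unfolding recursive_arity_def by blast
qed

lemma recursive_arity_Least:
  assumes "recursive_arity (Suc k) f" "\<And>xs. length xs = k \<Longrightarrow> \<exists>n. f (n # xs) = 0"
  shows "recursive_arity k (\<lambda>xs. LEAST n. f (n # xs) = 0)"
proof -
  obtain p where p: "\<And>xs. length xs = Suc k \<Longrightarrow> computes p xs (f xs)" using assms(1) by (auto simp: recursive_arity_def)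
  have "computes (Mu p) xs (LEAST n. f (n # xs) = 0)" if l: "length xs = k" for xs
  proof (rule computes.mu)
    have "f ((LEAST n. f (n # xs) = 0) # xs) = 0"
      using assms(2)[OF l] by (rule LeastI_ex)
    with p[of "(LEAST n. f (n # xs) = 0) # xs"] l
    show "computes p ((LEAST n. f (n # xs) = 0) # xs) 0" by simp
  next
    show "\<forall>m<LEAST n. f (n # xs) = 0. \<exists>y. computes p (m # xs) (Suc y)"
    proof (intro allI impI)
      fix m assume "m < (LEAST n. f (n # xs) = 0)"
      then have "f (m # xs) \<noteq> 0" by (rule not_less_Least)
      then obtain y where "f (m # xs) = Suc y" using not0_implies_Suc by blast
      then show "\<exists>y. computes p (m # xs) (Suc y)" using p[of "m # xs"] l by force
    qed
  qed
  then show ?thesis unfolding recursive_arity_def by blast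
qed

lemma recursive_arity_cong:
  assumes "recursive_arity k f" "\<And>xs. length xs = k \<Longrightarrow> f xs = g xs"
  shows "recursive_arity k g"
  using assms unfolding recursive_arity_def by auto

lemma recursive_arity_add2: "recursive_arity 2 (\<lambda>xs. xs ! 0 + xs ! 1)"
proof -
  have "recursive_arity (Suc (Suc 0)) (\<lambda>xs. rec_nat (tl xs ! 0) (\<lambda>n y. Suc ((n # y # tl xs) ! 1)) (hd xs))"
    by (rule recursive_arity_rec[where g = "\<lambda>xs. Suc (xs ! 1)"])
       (auto intro: recursive_arity_nth recursive_arity_Suc)
  moreover have "rec_nat b (\<lambda>n y. Suc y) a = a + b" for a b :: nat by (induction a) auto
  ultimately show ?thesis
    by (auto elim!: recursive_arity_cong simp: length_Suc_conv numeral_2_eq_2)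
qed

lemma recursive_arity_add:
  "recursive_arity k a \<Longrightarrow> recursive_arity k b \<Longrightarrow> recursive_arity k (\<lambda>xs. a xs + b xs)"
  using recursive_arity_comp2[OF recursive_arity_add2] by simp

lemma recursive_arity_pred1: "recursive_arity 1 (\<lambda>xs. xs ! 0 - 1)"
proof -
  have "recursive_arity (Suc 0) (\<lambda>xs. rec_nat 0 (\<lambda>n y. (n # y # tl xs) ! 0) (hd xs))"
    by (rule recursive_arity_rec[where g = "\<lambda>xs. xs ! 0"])
       (auto intro: recursive_arity_nth recursive_arity_const)
  moreover have "rec_nat 0 (\<lambda>n y. n) a = a - 1" for a :: nat by (cases a) auto
  ultimately show ?thesis
    by (auto elim!: recursive_arity_cong simp: length_Suc_conv)
qed

lemma recursive_arity_pred: "recursive_arity k a \<Longrightarrow> recursive_arity k (\<lambda>xs. a xs - 1)"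
  using recursive_arity_comp1[OF recursive_arity_pred1, of k a] by simp

lemma recursive_arity_diff2: "recursive_arity 2 (\<lambda>xs. xs ! 1 - xs ! 0)"
proof -
  have "recursive_arity (Suc (Suc 0)) (\<lambda>xs. rec_nat (tl xs ! 0) (\<lambda>n y. (n # y # tl xs) ! 1 - 1) (hd xs))"
    by (rule recursive_arity_rec[where g = "\<lambda>xs. xs ! 1 - 1"])
       (intro recursive_arity_nth recursive_arity_pred; simp)+
  moreover have "rec_nat b (\<lambda>n y. y - Suc 0) a = b - a" for a b :: nat by (induction a) auto
  ultimately show ?thesis
    by (auto elim!: recursive_arity_cong simp: length_Suc_conv numeral_2_eq_2)
qed

lemma recursive_arity_diff:
  "recursive_arity k a \<Longrightarrow> recursive_arity k b \<Longrightarrow> recursive_arity k (\<lambda>xs. a xs - b xs)"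
  using recursive_arity_comp2[OF recursive_arity_diff2, of k b a] by simp

lemma recursive_arity_triangle1: "recursive_arity 1 (\<lambda>xs. triangle (xs ! 0))"
proof -
  have "recursive_arity (Suc 0)
      (\<lambda>xs. rec_nat 0 (\<lambda>n y. (n # y # tl xs) ! 1 + Suc ((n # y # tl xs) ! 0)) (hd xs))"
    by (rule recursive_arity_rec[where g = "\<lambda>xs. xs ! 1 + Suc (xs ! 0)"])
       (intro recursive_arity_nth recursive_arity_const recursive_arity_add recursive_arity_Suc; simp)+
  moreover have "rec_nat 0 (\<lambda>n y. Suc (y + n)) a = triangle a" for a :: nat
    by (induction a) auto
  ultimately show ?thesis
    by (auto elim!: recursive_arity_cong simp: length_Suc_conv)
qed

lemma recursive_arity_triangle:
  "recursive_arity k a \<Longrightarrow> recursive_arity k (\<lambda>xs. triangle (a xs))"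
  using recursive_arity_comp1[OF recursive_arity_triangle1] by simp

lemma recursive_arity_prod_encode:
  "recursive_arity k a \<Longrightarrow> recursive_arity k b \<Longrightarrow> recursive_arity k (\<lambda>xs. prod_encode (a xs, b xs))"
  unfolding prod_encode_def by (simp add: recursive_arity_add recursive_arity_triangle)

lemma le_triangle: "n \<le> triangle n"
  by (induction n) auto

text \<open>
  The sum of the components of the pair coded by \<open>z\<close>. Pairs are enumerated diagonal by diagonal, and
  \<open>triangle (Suc s)\<close> is the first code beyond the diagonal \<open>s\<close>. Given the sum, both projections are
  truncated differences, so one unbounded search inverts the pairing.
\<close>

definition cantor_diagonal :: "nat \<Rightarrow> nat" where
  "cantor_diagonal z = (LEAST s. Suc z - triangle (Suc s) = 0)"

lemma cantor_diagonal_prod_encode: "cantor_diagonal (prod_encode (m, n)) = m + n"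
  unfolding cantor_diagonal_def
proof (rule Least_equality)
  show "Suc (prod_encode (m, n)) - triangle (Suc (m + n)) = 0"
    by (simp add: prod_encode_def)
next
  fix s assume s: "Suc (prod_encode (m, n)) - triangle (Suc s) = 0"
  show "m + n \<le> s"
  proof (rule ccontr)
    assume "\<not> m + n \<le> s"
    then obtain d where d: "m + n = Suc s + d" using less_iff_Suc_add[of s "m + n"] by auto
    have "triangle (Suc s) \<le> triangle (Suc s + d)" by (induction d) auto
    with s d show False by (simp add: prod_encode_def)
  qed
qed

lemma prod_decode_eq:
  "fst (prod_decode z) = z - triangle (cantor_diagonal z)"
  "snd (prod_decode z) = cantor_diagonal z - fst (prod_decode z)"
proof -
  obtain m n where z: "z = prod_encode (m, n)" by (metis prod_decode_inverse surj_pair)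
  then show "fst (prod_decode z) = z - triangle (cantor_diagonal z)"
    "snd (prod_decode z) = cantor_diagonal z - fst (prod_decode z)"
    by (simp_all add: cantor_diagonal_prod_encode prod_encode_inverse) (simp add: prod_encode_def)
qed

lemma recursive_arity_cantor_diagonal: "recursive_arity 1 (\<lambda>xs. cantor_diagonal (xs ! 0))"
proof -
  have "recursive_arity 1 (\<lambda>xs. LEAST n. Suc ((n # xs) ! 1) - triangle (Suc ((n # xs) ! 0)) = 0)"
  proof (rule recursive_arity_Least)
    show "recursive_arity (Suc 1) (\<lambda>xs. Suc (xs ! 1) - triangle (Suc (xs ! 0)))"
      by (intro recursive_arity_diff recursive_arity_triangle recursive_arity_Suc recursive_arity_nth) auto
  next
    show "\<exists>n. Suc ((n # xs) ! 1) - triangle (Suc ((n # xs) ! 0)) = 0" for xs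
      using le_triangle[of "Suc (xs ! 0)"] by (intro exI[of _ "xs ! 0"]) simp
  qed
  then show ?thesis by (simp add: cantor_diagonal_def)
qed

lemma recursive_arity_fst: "recursive_arity k a \<Longrightarrow> recursive_arity k (\<lambda>xs. fst (prod_decode (a xs)))"
  using recursive_arity_comp1[OF recursive_arity_cantor_diagonal, of k a]
  unfolding prod_decode_eq by (simp add: recursive_arity_diff recursive_arity_triangle)

lemma recursive_arity_snd: "recursive_arity k a \<Longrightarrow> recursive_arity k (\<lambda>xs. snd (prod_decode (a xs)))"
  using recursive_arity_comp1[OF recursive_arity_cantor_diagonal, of k a] recursive_arity_fst[of k a]
  unfolding prod_decode_eq(2) by (simp add: recursive_arity_diff)

section \<open>Closure properties of unary recursive functions\<close>

abbreviation pfst :: "nat \<Rightarrow> nat" where "pfst z \<equiv> fst (prod_decode z)"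
abbreviation psnd :: "nat \<Rightarrow> nat" where "psnd z \<equiv> snd (prod_decode z)"

lemma recursive_fun_iff: "recursive_fun f \<longleftrightarrow> recursive_arity 1 (\<lambda>xs. f (xs ! 0))"
proof -
  have "(\<forall>n. computes p [n] (f n)) \<longleftrightarrow> (\<forall>xs. length xs = 1 \<longrightarrow> computes p xs (f (xs ! 0)))" for p
    by (auto simp: length_Suc_conv)
  then show ?thesis unfolding recursive_fun_def recursive_arity_def by simp
qed

lemma recursive_fun_comp: "recursive_fun f \<Longrightarrow> recursive_fun a \<Longrightarrow> recursive_fun (\<lambda>x. f (a x))"
  unfolding recursive_fun_iff
  by (drule (1) recursive_arity_comp1) simp

lemma recursive_fun_arity2:
  assumes "recursive_arity 2 f" "recursive_fun a" "recursive_fun b"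
  shows "recursive_fun (\<lambda>x. f [a x, b x])"
  using recursive_arity_comp2[OF assms(1)] assms(2,3) unfolding recursive_fun_iff by blast

named_theorems recursive_intros

lemma recursive_fun_id [recursive_intros]: "recursive_fun (\<lambda>x. x)"
  unfolding recursive_fun_iff by (simp add: recursive_arity_nth)

lemma recursive_fun_const [recursive_intros]: "recursive_fun (\<lambda>_. c)"
  unfolding recursive_fun_iff by (rule recursive_arity_const)

lemma recursive_fun_Suc [recursive_intros]:
  "recursive_fun a \<Longrightarrow> recursive_fun (\<lambda>x. Suc (a x))"
  unfolding recursive_fun_iff by (rule recursive_arity_Suc)

lemma recursive_fun_add [recursive_intros]:
  "recursive_fun a \<Longrightarrow> recursive_fun b \<Longrightarrow> recursive_fun (\<lambda>x. a x + b x)"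
  unfolding recursive_fun_iff by (rule recursive_arity_add)

lemma recursive_fun_diff [recursive_intros]:
  "recursive_fun a \<Longrightarrow> recursive_fun b \<Longrightarrow> recursive_fun (\<lambda>x. a x - b x)"
  unfolding recursive_fun_iff by (rule recursive_arity_diff)

lemma recursive_fun_prod_encode [recursive_intros]:
  "recursive_fun a \<Longrightarrow> recursive_fun b \<Longrightarrow> recursive_fun (\<lambda>x. prod_encode (a x, b x))"
  unfolding recursive_fun_iff by (rule recursive_arity_prod_encode)

lemma recursive_fun_pfst [recursive_intros]: "recursive_fun a \<Longrightarrow> recursive_fun (\<lambda>x. pfst (a x))"
  unfolding recursive_fun_iff by (rule recursive_arity_fst)

lemma recursive_fun_psnd [recursive_intros]: "recursive_fun a \<Longrightarrow> recursive_fun (\<lambda>x. psnd (a x))"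
  unfolding recursive_fun_iff by (rule recursive_arity_snd)

text \<open>
  A function under a binder becomes a unary function whose argument codes the bound variables together
  with the parameter \<open>x\<close>. The same device serves for bounded quantifiers and for search, so that
  backward resolution with \<open>recursive_intros\<close> reduces a goal with binders to projections.
\<close>

lemma recursive_fun_rec_nat [recursive_intros]:
  assumes a: "recursive_fun a"
    and s: "recursive_fun (\<lambda>z. s (pfst z) (pfst (psnd z)) (psnd (psnd z)))"
    and b: "recursive_fun b"
  shows "recursive_fun (\<lambda>x. rec_nat (a x) (\<lambda>n y. s n y x) (b x))"
proof -
  have enc: "recursive_arity 3 (\<lambda>xs. prod_encode (xs ! 0, prod_encode (xs ! 1, xs ! 2)))"
    by (intro recursive_arity_prod_encode recursive_arity_nth) auto
  have g: "recursive_arity 3 (\<lambda>xs. s (xs ! 0) (xs ! 1) (xs ! 2))"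
    using recursive_arity_comp1[OF s[unfolded recursive_fun_iff] enc]
    by simp
  have "recursive_arity (Suc 1) (\<lambda>xs. rec_nat (a (tl xs ! 0))
      (\<lambda>n y. s ((n # y # tl xs) ! 0) ((n # y # tl xs) ! 1) ((n # y # tl xs) ! 2)) (hd xs))"
    by (rule recursive_arity_rec[where g = "\<lambda>xs. s (xs ! 0) (xs ! 1) (xs ! 2)"])
       (use a g in \<open>auto simp: recursive_fun_iff eval_nat_numeral\<close>)
  then have "recursive_arity 2 (\<lambda>xs. rec_nat (a (xs ! 1)) (\<lambda>n y. s n y (xs ! 1)) (xs ! 0))"
    by (auto elim!: recursive_arity_cong simp: length_Suc_conv eval_nat_numeral)
  from recursive_fun_arity2[OF this b recursive_fun_id] show ?thesis by simp
qed


lemma recursive_fun_Least: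
  assumes f: "recursive_fun (\<lambda>z. f (pfst z) (psnd z))" and ex: "\<And>x. \<exists>n. f n x = 0"
  shows "recursive_fun (\<lambda>x. LEAST n. f n x = 0)"
proof -
  have enc: "recursive_arity (Suc 1) (\<lambda>xs. prod_encode (xs ! 0, xs ! 1))"
    by (intro recursive_arity_prod_encode recursive_arity_nth) auto
  have "recursive_arity 1 (\<lambda>xs. LEAST n. f ((n # xs) ! 0) ((n # xs) ! 1) = 0)"
    using recursive_arity_comp1[OF f[unfolded recursive_fun_iff] enc] ex
    by (intro recursive_arity_Least) simp_all
  then show ?thesis unfolding recursive_fun_iff by simp
qed

definition recursive_pred :: "(nat \<Rightarrow> bool) \<Rightarrow> bool" where
  "recursive_pred P \<longleftrightarrow> recursive_fun (\<lambda>x. if P x then 1 else 0)"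

lemma recursive_pred_comp: "recursive_pred P \<Longrightarrow> recursive_fun a \<Longrightarrow> recursive_pred (\<lambda>x. P (a x))"
  unfolding recursive_pred_def by (rule recursive_fun_comp)

lemma recursive_fun_If [recursive_intros]:
  assumes "recursive_pred P" "recursive_fun a" "recursive_fun b"
  shows "recursive_fun (\<lambda>x. if P x then a x else b x)"
proof -
  have "recursive_fun (\<lambda>x. rec_nat (b x) (\<lambda>_ _. a x) (if P x then 1 else 0))"
    using assms(1) unfolding recursive_pred_def
    by (intro recursive_intros assms(3) recursive_fun_comp[OF assms(2)])
  then show ?thesis by (rule back_subst[of recursive_fun]) auto
qed

lemma recursive_pred_le [recursive_intros]:
  assumes "recursive_fun a" "recursive_fun b"
  shows "recursive_pred (\<lambda>x. a x \<le> b x)"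
proof -
  have "recursive_fun (\<lambda>x. 1 - (a x - b x))" by (intro recursive_intros assms)
  then show ?thesis unfolding recursive_pred_def
    by (rule back_subst[of recursive_fun]) auto
qed

lemma recursive_pred_not [recursive_intros]:
  assumes "recursive_pred P"
  shows "recursive_pred (\<lambda>x. \<not> P x)"
proof -
  have "recursive_fun (\<lambda>x. if P x then 0 else 1)" by (intro recursive_intros assms)
  then show ?thesis unfolding recursive_pred_def by (rule back_subst[of recursive_fun]) auto
qed

lemma recursive_pred_conj [recursive_intros]:
  assumes "recursive_pred P" "recursive_pred Q"
  shows "recursive_pred (\<lambda>x. P x \<and> Q x)"
proof -
  have "recursive_fun (\<lambda>x. if P x then (if Q x then 1 else 0) else 0)" by (intro recursive_intros assms)
  then show ?thesis unfolding recursive_pred_def by (rule back_subst[of recursive_fun]) auto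
qed

lemma recursive_pred_disj [recursive_intros]:
  assumes "recursive_pred P" "recursive_pred Q"
  shows "recursive_pred (\<lambda>x. P x \<or> Q x)"
proof -
  have "recursive_pred (\<lambda>x. \<not> (\<not> P x \<and> \<not> Q x))" by (intro recursive_intros assms)
  then show ?thesis by simp
qed

lemma recursive_pred_imp [recursive_intros]:
  assumes "recursive_pred P" "recursive_pred Q"
  shows "recursive_pred (\<lambda>x. P x \<longrightarrow> Q x)"
proof -
  have "recursive_pred (\<lambda>x. \<not> P x \<or> Q x)" by (intro recursive_intros assms)
  then show ?thesis by simp
qed

lemma recursive_pred_eq [recursive_intros]:
  assumes "recursive_fun a" "recursive_fun b"
  shows "recursive_pred (\<lambda>x. a x = b x)"
proof -
  have "recursive_pred (\<lambda>x. a x \<le> b x \<and> b x \<le> a x)" by (intro recursive_intros assms)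
  then show ?thesis by (simp add: eq_iff)
qed

lemma recursive_pred_less [recursive_intros]:
  assumes "recursive_fun a" "recursive_fun b"
  shows "recursive_pred (\<lambda>x. a x < b x)"
proof -
  have "recursive_pred (\<lambda>x. \<not> b x \<le> a x)" by (intro recursive_intros assms)
  then show ?thesis by (simp add: not_le)
qed

lemma recursive_pred_bex_less [recursive_intros]:
  assumes "recursive_pred (\<lambda>z. P (pfst z) (psnd z))" "recursive_fun b"
  shows "recursive_pred (\<lambda>x. \<exists>i<b x. P i x)"
proof -
  have "recursive_pred (\<lambda>z. P (pfst z) (psnd (psnd z)))"
  proof -
    have "recursive_fun (\<lambda>z. prod_encode (pfst z, psnd (psnd z)))" by (intro recursive_intros)
    from recursive_pred_comp[OF assms(1) this] show ?thesis by simp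
  qed
  then have "recursive_fun (\<lambda>x. rec_nat 0 (\<lambda>i y. if P i x then 1 else y) (b x))"
    by (intro recursive_intros assms)
  moreover have "rec_nat 0 (\<lambda>i y. if P i x then 1 else y) n = (if \<exists>i<n. P i x then 1 else 0)" for n x
    by (induction n) (auto simp: less_Suc_eq)
  ultimately show ?thesis unfolding recursive_pred_def
    by (rule back_subst[of recursive_fun, OF _ ext])
qed

lemma recursive_pred_ball_less [recursive_intros]:
  assumes "recursive_pred (\<lambda>z. P (pfst z) (psnd z))" "recursive_fun b"
  shows "recursive_pred (\<lambda>x. \<forall>i<b x. P i x)"
proof -
  have "recursive_pred (\<lambda>x. \<not> (\<exists>i<b x. \<not> P i x))" by (intro recursive_intros assms)
  then show ?thesis by simp
qed

lemma recursive_fun_Least_pred: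
  assumes "recursive_pred (\<lambda>z. P (pfst z) (psnd z))" and "\<And>x. \<exists>n. P n x"
  shows "recursive_fun (\<lambda>x. LEAST n. P n x)"
proof -
  have "recursive_fun (\<lambda>x. LEAST n. (if P n x then 0 else 1 :: nat) = 0)"
    by (rule recursive_fun_Least) (intro recursive_intros assms, simp add: assms)
  moreover have "((if P n x then 0 else 1 :: nat) = 0) = P n x" for n x by simp
  ultimately show ?thesis by simp
qed

lemma recursive_pred_mem_finite:
  assumes "finite A" "recursive_fun a"
  shows "recursive_pred (\<lambda>x. a x \<in> A)"
  using assms(1)
proof (induction A rule: finite_induct)
  case empty
  have "recursive_pred (\<lambda>x. a x < 0)" by (intro recursive_intros assms)
  then show ?case by simp
next
  case (insert c A)
  then have "recursive_pred (\<lambda>x. a x = c \<or> a x \<in> A)" by (intro recursive_intros assms)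
  then show ?case by simp
qed

lemma recursive_set_iff: "recursive_set A \<longleftrightarrow> recursive_pred (\<lambda>x. x \<in> A)"
  unfolding recursive_set_def recursive_pred_def ..

lemma recursive_rel_iff: "recursive_rel R \<longleftrightarrow> recursive_pred (\<lambda>z. R (pfst z) (psnd z))"
proof -
  have "(\<forall>m n. computes p [m, n] (if R m n then 1 else 0)) \<longleftrightarrow>
      (\<forall>xs. length xs = 2 \<longrightarrow> computes p xs (if R (xs ! 0) (xs ! 1) then 1 else 0))" for p
    by (auto simp: length_Suc_conv eval_nat_numeral)
  then have *: "recursive_rel R \<longleftrightarrow> recursive_arity 2 (\<lambda>xs. if R (xs ! 0) (xs ! 1) then 1 else 0)"
    unfolding recursive_rel_def recursive_arity_def by simp
  have "recursive_arity 2 (\<lambda>xs. if R (xs ! 0) (xs ! 1) then 1 else 0)"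
    if "recursive_pred (\<lambda>z. R (pfst z) (psnd z))"
  proof -
    have "recursive_arity 2 (\<lambda>xs. prod_encode (xs ! 0, xs ! 1))"
      by (intro recursive_arity_prod_encode recursive_arity_nth) auto
    from recursive_arity_comp1[OF that[unfolded recursive_pred_def recursive_fun_iff] this]
    show ?thesis by simp
  qed
  moreover have "recursive_pred (\<lambda>z. R (pfst z) (psnd z))"
    if "recursive_arity 2 (\<lambda>xs. if R (xs ! 0) (xs ! 1) then 1 else 0)"
    using recursive_fun_arity2[OF that recursive_fun_pfst[OF recursive_fun_id] recursive_fun_psnd[OF recursive_fun_id]]
    unfolding recursive_pred_def by simp
  ultimately show ?thesis using * by blast
qed

section \<open>Recursive list operations\<close>

definition recursive_list :: "(nat \<Rightarrow> nat list) \<Rightarrow> bool" where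
  "recursive_list f \<longleftrightarrow> recursive_fun (\<lambda>x. list_encode (f x))"

lemma recursive_list_comp: "recursive_list f \<Longrightarrow> recursive_fun a \<Longrightarrow> recursive_list (\<lambda>x. f (a x))"
  unfolding recursive_list_def by (rule recursive_fun_comp)

lemma recursive_list_decode [recursive_intros]:
  "recursive_fun a \<Longrightarrow> recursive_list (\<lambda>x. list_decode (a x))"
  unfolding recursive_list_def by simp

lemma recursive_fun_list_encode [recursive_intros]:
  "recursive_list f \<Longrightarrow> recursive_fun (\<lambda>x. list_encode (f x))"
  unfolding recursive_list_def .

lemma recursive_list_Nil [recursive_intros]: "recursive_list (\<lambda>_. [])"
  unfolding recursive_list_def by (intro recursive_intros)

lemma recursive_list_Cons [recursive_intros]:
  "recursive_fun a \<Longrightarrow> recursive_list f \<Longrightarrow> recursive_list (\<lambda>x. a x # f x)"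
  unfolding recursive_list_def list_encode.simps
  by (intro recursive_fun_Suc recursive_fun_prod_encode)

lemma recursive_pred_list_eq [recursive_intros]:
  assumes "recursive_list f" "recursive_list g"
  shows "recursive_pred (\<lambda>x. f x = g x)"
proof -
  have "recursive_pred (\<lambda>x. list_encode (f x) = list_encode (g x))"
    by (intro recursive_intros assms)
  then show ?thesis by (simp add: list_encode_eq)
qed

text \<open>
  On codes, tail and head are projections of the predecessor. The empty list has code \<open>0\<close>, and
  \<open>prod_decode 0 = (0, 0)\<close> makes the formulas right for it as well, with \<open>0\<close> as the default head.
\<close>

lemma prod_decode_0: "prod_decode 0 = (0, 0)"
  using prod_encode_inverse[of "(0, 0)"] by (simp add: prod_encode_def)

lemma list_encode_tl: "list_encode (tl xs) = psnd (list_encode xs - Suc 0)"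
  by (cases xs) (simp_all add: prod_decode_0)

lemma list_encode_hd: "nth_default 0 xs 0 = pfst (list_encode xs - Suc 0)"
  by (cases xs) (simp_all add: prod_decode_0)

lemma recursive_list_drop [recursive_intros]:
  assumes "recursive_fun a" "recursive_list f"
  shows "recursive_list (\<lambda>x. drop (a x) (f x))"
proof -
  have "recursive_fun (\<lambda>x. rec_nat (list_encode (f x)) (\<lambda>_ y. psnd (y - Suc 0)) (a x))"
    by (intro recursive_intros assms)
  moreover have "rec_nat (list_encode xs) (\<lambda>_ y. psnd (y - Suc 0)) n = list_encode (drop n xs)" for xs n
    by (induction n) (simp_all add: list_encode_tl[symmetric] drop_Suc flip: tl_drop)
  ultimately show ?thesis unfolding recursive_list_def by simp
qed

lemma recursive_fun_nth_default [recursive_intros]: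
  assumes "recursive_list f" "recursive_fun a"
  shows "recursive_fun (\<lambda>x. nth_default 0 (f x) (a x))"
proof -
  have "recursive_fun (\<lambda>x. pfst (list_encode (drop (a x) (f x)) - Suc 0))"
    by (intro recursive_intros assms)
  moreover have "nth_default 0 (drop n xs) 0 = nth_default 0 xs n" for n and xs :: "nat list"
    by (simp add: nth_default_def)
  ultimately show ?thesis by (simp add: list_encode_hd[symmetric])
qed

lemma recursive_fun_length [recursive_intros]:
  assumes "recursive_list f"
  shows "recursive_fun (\<lambda>x. length (f x))"
proof -
  have "recursive_list (\<lambda>z. f (psnd z))"
    by (rule recursive_list_comp[OF assms]) (intro recursive_intros)
  then have "recursive_fun (\<lambda>x. LEAST n. drop n (f x) = [])"
    by (intro recursive_fun_Least_pred recursive_intros) (auto intro: exI[of _ "length _"])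
  moreover have "(LEAST n. drop n xs = []) = length xs" for xs :: "nat list"
    by (rule Least_equality) auto
  ultimately show ?thesis by simp
qed

text \<open>
  Reversal onto an accumulator is a plain iteration, and appending is reversing twice.
\<close>

lemma recursive_list_rev_append:
  assumes f: "recursive_list f" and g: "recursive_list g"
  shows "recursive_list (\<lambda>x. rev (f x) @ g x)"
proof -
  have f': "recursive_list (\<lambda>z. f (psnd (psnd z)))"
    by (rule recursive_list_comp[OF f]) (intro recursive_intros)
  have "recursive_fun (\<lambda>x. rec_nat (list_encode (g x))
      (\<lambda>n y. list_encode (nth_default 0 (f x) n # list_decode y)) (length (f x)))"
    by (intro recursive_intros f g f')
  moreover have "n \<le> length xs \<Longrightarrow> rec_nat (list_encode ys) (\<lambda>n y. list_encode (nth_default 0 xs n # list_decode y)) n =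
      list_encode (rev (take n xs) @ ys)" for xs ys n
    by (induction n) (simp_all add: take_Suc_conv_app_nth nth_default_nth)
  ultimately show ?thesis unfolding recursive_list_def by simp
qed

lemma recursive_list_append [recursive_intros]:
  assumes "recursive_list f" "recursive_list g"
  shows "recursive_list (\<lambda>x. f x @ g x)"
  using recursive_list_rev_append[OF recursive_list_rev_append[OF assms(1) recursive_list_Nil] assms(2)]
  by simp

lemma recursive_pred_bex_set [recursive_intros]:
  assumes P: "recursive_pred (\<lambda>z. P (pfst z) (psnd z))" and f: "recursive_list f"
  shows "recursive_pred (\<lambda>x. \<exists>a\<in>set (f x). P a x)"
proof -
  have f': "recursive_list (\<lambda>z. f (psnd z))"
    by (rule recursive_list_comp[OF f]) (intro recursive_intros)
  have "recursive_pred (\<lambda>z. P (nth_default 0 (f (psnd z)) (pfst z)) (psnd z))"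
  proof -
    have "recursive_fun (\<lambda>z. prod_encode (nth_default 0 (f (psnd z)) (pfst z), psnd z))"
      by (intro recursive_intros f')
    from recursive_pred_comp[OF P this] show ?thesis by simp
  qed
  then have "recursive_pred (\<lambda>x. \<exists>i<length (f x). P (nth_default 0 (f x) i) x)"
    by (intro recursive_intros f)
  moreover have "(\<exists>i<length xs. P (nth_default 0 xs i) x) \<longleftrightarrow> (\<exists>a\<in>set xs. P a x)" for xs x
    unfolding in_set_conv_nth Bex_def by (metis nth_default_nth)
  ultimately show ?thesis by simp
qed

lemma recursive_pred_ball_set [recursive_intros]:
  assumes "recursive_pred (\<lambda>z. P (pfst z) (psnd z))" "recursive_list f"
  shows "recursive_pred (\<lambda>x. \<forall>a\<in>set (f x). P a x)"
proof -
  have "recursive_pred (\<lambda>x. \<not> (\<exists>a\<in>set (f x). \<not> P a x))" by (intro recursive_intros assms)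
  then show ?thesis by simp
qed

lemma recursive_pred_mem [recursive_intros]:
  assumes "recursive_fun a" and f: "recursive_list f"
  shows "recursive_pred (\<lambda>x. a x \<in> set (f x))"
proof -
  have "recursive_fun (\<lambda>z. a (psnd z))"
    by (intro recursive_fun_comp[OF assms(1)] recursive_intros)
  then have "recursive_pred (\<lambda>x. \<exists>b\<in>set (f x). b = a x)" by (intro recursive_intros f)
  then show ?thesis by simp
qed

section \<open>A universal recursively enumerable set\<close>

fun recf_encode :: "recf \<Rightarrow> nat" where
  "recf_encode Zero = prod_encode (0, 0)"
| "recf_encode Succ = prod_encode (1, 0)"
| "recf_encode (Proj i) = prod_encode (2, i)"
| "recf_encode (Comp f gs) =
    prod_encode (3, prod_encode (recf_encode f, list_encode (map recf_encode gs)))"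
| "recf_encode (PrimRec f g) = prod_encode (4, prod_encode (recf_encode f, recf_encode g))"
| "recf_encode (Mu f) = prod_encode (5, recf_encode f)"

text \<open>
  Codes the claim that the program with code \<open>p\<close> yields \<open>y\<close> on the arguments \<open>xs\<close>.
\<close>

definition judgement :: "nat \<Rightarrow> nat list \<Rightarrow> nat \<Rightarrow> nat" where
  "judgement p xs y = prod_encode (p, prod_encode (list_encode xs, y))"

abbreviation (input) "program t \<equiv> pfst t"
abbreviation (input) "arguments t \<equiv> list_decode (pfst (psnd t))"
abbreviation (input) "result t \<equiv> psnd (psnd t)"

lemma judgement_sel [simp]:
  "program (judgement p xs y) = p" "arguments (judgement p xs y) = xs" "result (judgement p xs y) = y"
  by (simp_all add: judgement_def)

lemma judgement_collapse: "judgement (program t) (arguments t) (result t) = t"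
  by (simp add: judgement_def)

text \<open>
  The disjuncts are the rules of \<^const>\<open>computes\<close>, selected by the tag of the program, with premises
  taken from \<open>D\<close>. The arguments passed on by a composition and the previous value of a primitive
  recursion are read off from a member \<open>u\<close> of \<open>D\<close>, and this keeps all quantifiers bounded.
\<close>

definition follows_from :: "nat list \<Rightarrow> nat \<Rightarrow> bool" where
  "follows_from D t \<longleftrightarrow>
    pfst (program t) = 0 \<and> result t = 0 \<or>
    pfst (program t) = 1 \<and> result t \<noteq> 0 \<and> arguments t = [result t - 1] \<or>
    pfst (program t) = 2 \<and> psnd (program t) < length (arguments t) \<and>
      result t = nth_default 0 (arguments t) (psnd (program t)) \<or>
    pfst (program t) = 3 \<and>
      (\<exists>u\<in>set D. program u = pfst (psnd (program t)) \<and> result u = result t \<and>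
        length (arguments u) = length (list_decode (psnd (psnd (program t)))) \<and>
        (\<forall>i<length (arguments u).
          judgement (nth_default 0 (list_decode (psnd (psnd (program t)))) i) (arguments t)
            (nth_default 0 (arguments u) i) \<in> set D)) \<or>
    pfst (program t) = 4 \<and> 0 < length (arguments t) \<and>
      (if nth_default 0 (arguments t) 0 = 0
       then judgement (pfst (psnd (program t))) (drop 1 (arguments t)) (result t) \<in> set D
       else \<exists>u\<in>set D. program u = program t \<and>
         arguments u = (nth_default 0 (arguments t) 0 - 1) # drop 1 (arguments t) \<and>
         judgement (psnd (psnd (program t)))
           ((nth_default 0 (arguments t) 0 - 1) # result u # drop 1 (arguments t)) (result t) \<in> set D) \<or>
    pfst (program t) = 5 \<and> judgement (psnd (program t)) (result t # arguments t) 0 \<in> set D \<and>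
      (\<forall>m<result t. \<exists>u\<in>set D. program u = psnd (program t) \<and> arguments u = m # arguments t \<and>
        result u \<noteq> 0)"

text \<open>
  The latest judgement comes first, so that each one is justified by its tail.
\<close>

primrec derivation :: "nat list \<Rightarrow> bool" where
  "derivation [] \<longleftrightarrow> True"
| "derivation (t # D) \<longleftrightarrow> follows_from D t \<and> derivation D"

definition derivable :: "nat \<Rightarrow> bool" where
  "derivable t \<longleftrightarrow> (\<exists>D. derivation D \<and> t \<in> set D)"

lemma follows_from_mono: "follows_from D t \<Longrightarrow> set D \<subseteq> set D' \<Longrightarrow> follows_from D' t"
  unfolding follows_from_def
  by (elim disjE; simp split: if_splits; blast)

lemma derivation_append: "derivation D \<Longrightarrow> derivation E \<Longrightarrow> derivation (D @ E)"
  by (induction D) (auto elim: follows_from_mono)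

lemma derivable_finite:
  assumes "finite T" "\<And>t. t \<in> T \<Longrightarrow> derivable t"
  shows "\<exists>D. derivation D \<and> T \<subseteq> set D"
  using assms
proof (induction T rule: finite_induct)
  case empty
  have "derivation []" by simp
  then show ?case by blast
next
  case (insert t T)
  then obtain D E where "derivation D" "T \<subseteq> set D" "derivation E" "t \<in> set E"
    unfolding derivable_def by blast
  then show ?case by (intro exI[of _ "D @ E"]) (auto intro: derivation_append)
qed

text \<open>
  Derivations can be concatenated, since having more judgements at hand does no harm. So finitely many
  derivable premises occur together in one derivation, which the conclusion then extends.
\<close>

lemma derivableI:
  assumes "finite T" "\<And>u. u \<in> T \<Longrightarrow> derivable u" "\<And>D. T \<subseteq> set D \<Longrightarrow> follows_from D t"
  shows "derivable t"
proof -
  obtain D where "derivation D" "T \<subseteq> set D" using derivable_finite[OF assms(1,2)] by blast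
  then have "derivation (t # D)" using assms(3) by simp
  then show ?thesis unfolding derivable_def by (intro exI[of _ "t # D"]) simp
qed

lemma computes_imp_derivable:
  "computes p xs y \<Longrightarrow> derivable (judgement (recf_encode p) xs y)"
proof (induction rule: computes.induct)
  case (zero xs)
  show ?case by (rule derivableI[of "{}"]) (simp_all add: follows_from_def)
next
  case (succ x)
  show ?case by (rule derivableI[of "{}"]) (simp_all add: follows_from_def)
next
  case (proj i xs)
  then show ?case by - (rule derivableI[of "{}"], simp_all add: follows_from_def nth_default_nth)
next
  case (comp xs gs ys f z)
  let ?u = "judgement (recf_encode f) ys z"
  let ?v = "\<lambda>i. judgement (recf_encode (gs ! i)) xs (ys ! i)"
  from comp.IH(1) have l: "length gs = length ys"
    and gs: "\<And>i. i < length ys \<Longrightarrow> derivable (?v i)"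
    by (auto simp: list_all2_conv_all_nth)
  show ?case
  proof (rule derivableI[of "insert ?u (?v ` {..<length ys})"])
    fix D assume D: "insert ?u (?v ` {..<length ys}) \<subseteq> set D"
    then have "\<And>i. i < length ys \<Longrightarrow> ?v i \<in> set D" by blast
    with l D have "\<exists>u\<in>set D. program u = recf_encode f \<and> result u = z \<and>
        length (arguments u) = length (map recf_encode gs) \<and>
        (\<forall>i<length (arguments u). judgement (nth_default 0 (map recf_encode gs) i) xs
          (nth_default 0 (arguments u) i) \<in> set D)"
      by (intro bexI[of _ ?u]) (simp_all add: nth_default_nth)
    then show "follows_from D (judgement (recf_encode (Comp f gs)) xs z)"
      by (simp add: follows_from_def)
  qed (use comp.IH(2) gs in auto)
next
  case (primrec_zero f xs y g)
  then show ?case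
    by - (rule derivableI[of "{judgement (recf_encode f) xs y}"], auto simp: follows_from_def)
next
  case (primrec_Suc f g n xs y z)
  let ?u = "judgement (recf_encode (PrimRec f g)) (n # xs) y"
  show ?case
    by (rule derivableI[of "{?u, judgement (recf_encode g) (n # y # xs) z}"])
       (use primrec_Suc.IH in \<open>auto simp: follows_from_def intro!: bexI[of _ ?u]\<close>)
next
  case (mu f n xs)
  then obtain v where v: "\<And>m. m < n \<Longrightarrow> derivable (judgement (recf_encode f) (m # xs) (Suc (v m)))"
    by metis
  let ?v = "\<lambda>m. judgement (recf_encode f) (m # xs) (Suc (v m))"
  let ?u = "judgement (recf_encode f) (n # xs) 0"
  show ?case
  proof (rule derivableI[of "insert ?u (?v ` {..<n})"])
    fix D assume D: "insert ?u (?v ` {..<n}) \<subseteq> set D"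
    then have "\<And>m. m < n \<Longrightarrow> ?v m \<in> set D" by blast
    then have "\<exists>u\<in>set D. program u = recf_encode f \<and> arguments u = m # xs \<and> result u \<noteq> 0" if "m < n" for m
      using that by (intro bexI[of _ "?v m"]) simp_all
    with D show "follows_from D (judgement (recf_encode (Mu f)) xs n)"
      by (simp add: follows_from_def)
  qed (use mu.IH(1) v in auto)
qed

text \<open>
  Soundness of a single step: each disjunct is read back as the rule that it encodes. The members of
  \<open>D\<close> it appeals to speak about codes of subprograms, by the form of \<^const>\<open>recf_encode\<close>.
\<close>

lemma follows_from_imp_computes:
  assumes D: "\<And>p xs y. judgement (recf_encode p) xs y \<in> set D \<Longrightarrow> computes p xs y"
    and t: "follows_from D (judgement (recf_encode p) xs y)"
  shows "computes p xs y"
proof (cases p)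
  case Zero
  with t show ?thesis by (simp add: follows_from_def computes.zero)
next
  case Succ
  with t have "xs = [y - 1]" "y \<noteq> 0" by (simp_all add: follows_from_def)
  then show ?thesis using computes.succ[of "y - 1"] Succ by simp
next
  case (Proj i)
  with t have "i < length xs" "y = xs ! i" by (auto simp: follows_from_def nth_default_nth)
  then show ?thesis using Proj by (auto intro: computes.proj)
next
  case (Comp f gs)
  with t obtain u where u: "u \<in> set D" "program u = recf_encode f" "result u = y"
      "length (arguments u) = length gs"
      "\<And>i. i < length gs \<Longrightarrow>
        judgement (nth_default 0 (map recf_encode gs) i) xs (nth_default 0 (arguments u) i) \<in> set D"
    by (auto simp: follows_from_def)
  from u(1-3) have "computes f (arguments u) y"
    by (intro D) (metis judgement_collapse)
  moreover have "list_all2 (\<lambda>g y. computes g xs y) gs (arguments u)"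
    using u(4,5) by (auto simp: list_all2_conv_all_nth nth_default_nth intro: D)
  ultimately show ?thesis unfolding Comp by (intro computes.comp)
next
  case (PrimRec f g)
  with t obtain n zs where xs: "xs = n # zs"
    by (cases xs) (auto simp: follows_from_def)
  show ?thesis
  proof (cases n)
    case 0
    with t PrimRec xs have "computes f zs y" by (intro D) (simp add: follows_from_def)
    then show ?thesis using PrimRec xs 0 by (simp add: computes.primrec_zero)
  next
    case (Suc m)
    with t PrimRec xs obtain u where u: "u \<in> set D" "program u = recf_encode p" "arguments u = m # zs"
        "judgement (recf_encode g) (m # result u # zs) y \<in> set D"
      by (auto simp: follows_from_def)
    from u(1-3) have "computes p (m # zs) (result u)"
      by (intro D) (metis judgement_collapse)
    with D[OF u(4)] show ?thesis using PrimRec xs Suc by (auto intro: computes.primrec_Suc)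
  qed
next
  case (Mu f)
  with t have 1: "judgement (recf_encode f) (y # xs) 0 \<in> set D"
    and 2: "\<And>m. m < y \<Longrightarrow> \<exists>u\<in>set D. program u = recf_encode f \<and> arguments u = m # xs \<and> result u \<noteq> 0"
    by (simp_all add: follows_from_def)
  have "\<exists>v. computes f (m # xs) (Suc v)" if m: "m < y" for m
  proof -
    from 2[OF m] obtain u where u: "u \<in> set D" "program u = recf_encode f" "arguments u = m # xs" "result u \<noteq> 0"
      by blast
    then have "computes f (m # xs) (result u)" by (intro D) (metis judgement_collapse)
    with u(4) show ?thesis by (metis not0_implies_Suc)
  qed
  with D[OF 1] show ?thesis unfolding Mu by (blast intro: computes.mu)
qed

lemma derivation_imp_computes:
  "derivation D \<Longrightarrow> judgement (recf_encode p) xs y \<in> set D \<Longrightarrow> computes p xs y"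
proof (induction D arbitrary: p xs y)
  case (Cons t D)
  then show ?case by (auto intro: follows_from_imp_computes)
qed simp

lemma derivable_iff: "derivable (judgement (recf_encode p) xs y) \<longleftrightarrow> computes p xs y"
  using computes_imp_derivable derivation_imp_computes unfolding derivable_def by blast

lemma recursive_fun_judgement [recursive_intros]:
  "recursive_fun a \<Longrightarrow> recursive_list f \<Longrightarrow> recursive_fun b \<Longrightarrow> recursive_fun (\<lambda>x. judgement (a x) (f x) (b x))"
  unfolding judgement_def by (intro recursive_intros)

lemma recursive_pred_If [recursive_intros]:
  assumes "recursive_pred P" "recursive_pred Q" "recursive_pred R"
  shows "recursive_pred (\<lambda>x. if P x then Q x else R x)"
proof -
  have "recursive_pred (\<lambda>x. (P x \<longrightarrow> Q x) \<and> (\<not> P x \<longrightarrow> R x))" by (intro recursive_intros assms)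
  then show ?thesis by (simp add: if_bool_eq_conj)
qed

lemma recursive_pred_follows_from:
  "recursive_pred (\<lambda>z. follows_from (list_decode (pfst z)) (psnd z))"
  unfolding follows_from_def by (intro recursive_intros)

text \<open>
  Unfolding the recursion into one bounded quantifier makes the recursiveness rules applicable.
\<close>

lemma derivation_iff:
  "derivation D \<longleftrightarrow> (\<forall>k<length D. follows_from (drop (Suc k) D) (nth_default 0 D k))"
proof (induction D)
  case (Cons t D)
  then show ?case by (simp add: All_less_Suc2)
qed simp

lemma recursive_pred_derivation [recursive_intros]:
  assumes "recursive_list f"
  shows "recursive_pred (\<lambda>x. derivation (f x))"
proof -
  have f: "recursive_list (\<lambda>z. f (psnd z))"
    by (rule recursive_list_comp[OF assms]) (intro recursive_intros)
  have "recursive_fun (\<lambda>z. prod_encode (list_encode (drop (Suc (pfst z)) (f (psnd z))),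
      nth_default 0 (f (psnd z)) (pfst z)))"
    by (intro recursive_intros f)
  from recursive_pred_comp[OF recursive_pred_follows_from this]
  have "recursive_pred (\<lambda>z. follows_from (drop (Suc (pfst z)) (f (psnd z))) (nth_default 0 (f (psnd z)) (pfst z)))"
    by simp
  then show ?thesis unfolding derivation_iff by (intro recursive_intros assms)
qed

text \<open>
  A number \<open>e\<close> pairs a program with an input. Its witness \<open>w\<close> pairs a second input, on which the
  program answers \<open>1\<close>, with a derivation of that answer.
\<close>

definition universal_rel :: "nat \<Rightarrow> nat \<Rightarrow> bool" where
  "universal_rel e w \<longleftrightarrow> derivation (list_decode (psnd w)) \<and>
    judgement (pfst e) [psnd e, pfst w] 1 \<in> set (list_decode (psnd w))"

lemma recursive_rel_universal_rel: "recursive_rel universal_rel"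
  unfolding recursive_rel_iff universal_rel_def by (intro recursive_intros)

text \<open>
  If \<open>p\<close> decides \<open>R\<close>, then \<open>R n m\<close> holds exactly if some derivation shows that \<open>p\<close> answers \<open>1\<close> on
  \<open>[n, m]\<close>. So \<open>n\<close> is mapped to the pair of the code of \<open>p\<close> and \<open>n\<close>.
\<close>

lemma Sigma1_reducible_universal:
  assumes "Sigma1 A"
  shows "many_one_reducible A {e. \<exists>w. universal_rel e w}"
proof -
  obtain R p where p: "\<And>m n. computes p [m, n] (if R m n then 1 else 0)"
    and A: "A = {n. \<exists>m. R n m}"
    using assms unfolding Sigma1_def recursive_rel_def by blast
  have R: "R n m \<longleftrightarrow> computes p [n, m] 1" for n m
    using p[of n m] computes_deterministic[of p "[n, m]" 1 0] by (cases "R n m") auto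
  have "n \<in> A \<longleftrightarrow> (\<exists>w. universal_rel (prod_encode (recf_encode p, n)) w)" for n
  proof -
    have "(\<exists>w. universal_rel (prod_encode (recf_encode p, n)) w) \<longleftrightarrow>
        (\<exists>m D. derivation D \<and> judgement (recf_encode p) [n, m] 1 \<in> set D)"
      unfolding universal_rel_def by (metis fst_conv snd_conv prod_encode_inverse list_encode_inverse)
    also have "\<dots> \<longleftrightarrow> (\<exists>m. computes p [n, m] 1)"
      unfolding derivable_iff[symmetric] derivable_def by blast
    finally show ?thesis using A R by simp
  qed
  moreover have "recursive_fun (\<lambda>n. prod_encode (recf_encode p, n))"
    by (intro recursive_intros)
  ultimately show ?thesis unfolding many_one_reducible_def
    by (intro exI[of _ "\<lambda>n. prod_encode (recf_encode p, n)"]) simp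
qed

section \<open>Subshifts\<close>

lemma openin_full_shiftD:
  assumes "openin (full_shift S) U" "x \<in> U"
  obtains n :: nat where
    "\<And>z. range z \<subseteq> S \<Longrightarrow> (\<And>i. \<bar>i\<bar> \<le> int n \<Longrightarrow> z i = x i) \<Longrightarrow> z \<in> U"
proof -
  from assms obtain V where fin: "finite {i. V i \<noteq> S}" and x: "x \<in> Pi\<^sub>E UNIV V" and V: "Pi\<^sub>E UNIV V \<subseteq> U"
    unfolding full_shift_def openin_product_topology_alt by auto
  have "finite ((\<lambda>i. nat \<bar>i\<bar>) ` {i. V i \<noteq> S})" using fin by simp
  then obtain n where n: "\<And>i. V i \<noteq> S \<Longrightarrow> nat \<bar>i\<bar> \<le> n"
    unfolding finite_nat_set_iff_bounded_le by blast
  show thesis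
  proof (rule that[of n])
    fix z assume z: "range z \<subseteq> S" "\<And>i. \<bar>i\<bar> \<le> int n \<Longrightarrow> z i = x i"
    have "z i \<in> V i" for i
    proof (cases "V i = S")
      case True
      then show ?thesis using z(1) by auto
    next
      case False
      with n[of i] z(2)[of i] x show ?thesis by (auto simp: PiE_iff)
    qed
    then show "z \<in> U" using V by (auto simp: PiE_iff)
  qed
qed

lemma topspace_full_shift: "topspace (full_shift S) = {x. range x \<subseteq> S}"
  by (auto simp: full_shift_def PiE_iff)

text \<open>
  A basic open set restricts finitely many coordinates, all of them in some \<open>[-n, n]\<close>. So closedness is
  closure under limits of points that agree on growing central windows.
\<close>

lemma closedin_full_shift_iff:
  "closedin (full_shift S) X \<longleftrightarrow> (\<forall>x\<in>X. range x \<subseteq> S) \<and>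
    (\<forall>x. (\<forall>n::nat. \<exists>z\<in>X. \<forall>i. \<bar>i\<bar> \<le> int n \<longrightarrow> z i = x i) \<longrightarrow> x \<in> X)"
    (is "_ \<longleftrightarrow> ?S \<and> ?L")
proof (intro iffI conjI)
  assume cl: "closedin (full_shift S) X"
  show S: ?S using closedin_subset[OF cl] by (auto simp: topspace_full_shift)
  show ?L
  proof (intro allI impI)
    fix x assume x: "\<forall>n::nat. \<exists>z\<in>X. \<forall>i. \<bar>i\<bar> \<le> int n \<longrightarrow> z i = x i"
    have xS: "range x \<subseteq> S"
    proof clarify
      fix i
      obtain z where "z \<in> X" "z i = x i" using x[rule_format, of "nat \<bar>i\<bar>"] by auto
      then show "x i \<in> S" using S by (metis rangeI subsetD)
    qed
    show "x \<in> X"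
    proof (rule ccontr)
      assume "x \<notin> X"
      with xS have "x \<in> topspace (full_shift S) - X" by (simp add: topspace_full_shift)
      moreover have "openin (full_shift S) (topspace (full_shift S) - X)"
        using cl by (simp add: closedin_def)
      ultimately obtain n :: nat where
        "\<And>z. range z \<subseteq> S \<Longrightarrow> (\<And>i. \<bar>i\<bar> \<le> int n \<Longrightarrow> z i = x i) \<Longrightarrow> z \<in> topspace (full_shift S) - X"
        using openin_full_shiftD by blast
      moreover obtain z where "z \<in> X" "\<forall>i. \<bar>i\<bar> \<le> int n \<longrightarrow> z i = x i" using x by blast
      ultimately show False using S by blast
    qed
  qed
next
  assume "?S \<and> ?L"
  then have S: ?S and L: ?L by auto
  have "openin (full_shift S) (topspace (full_shift S) - X)"
    unfolding full_shift_def openin_product_topology_alt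
  proof
    fix x assume "x \<in> topspace (product_topology (\<lambda>_::int. discrete_topology S) UNIV) - X"
    then have x: "range x \<subseteq> S" "x \<notin> X" by (auto simp: PiE_iff)
    from x(2) L obtain n :: nat where n: "\<And>z. z \<in> X \<Longrightarrow> \<exists>i. \<bar>i\<bar> \<le> int n \<and> z i \<noteq> x i" by blast
    let ?V = "\<lambda>i. if \<bar>i\<bar> \<le> int n then {x i} else S"
    have "finite {i. ?V i \<noteq> S}"
      by (rule finite_subset[of _ "{- int n..int n}"]) auto
    moreover have "Pi\<^sub>E UNIV ?V \<subseteq> {z. range z \<subseteq> S} - X"
    proof
      fix z assume z: "z \<in> Pi\<^sub>E UNIV ?V"
      have "z i \<in> S" for i using z x(1) by (auto simp: PiE_iff split: if_splits)
      moreover have "z i = x i" if "\<bar>i\<bar> \<le> int n" for i using z that by (auto simp: PiE_iff split: if_splits)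
      ultimately show "z \<in> {z. range z \<subseteq> S} - X" using n by blast
    qed
    ultimately show "\<exists>U. finite {i \<in> UNIV. U i \<noteq> topspace (discrete_topology S)} \<and>
        (\<forall>i\<in>UNIV. openin (discrete_topology S) (U i)) \<and> x \<in> Pi\<^sub>E UNIV U \<and>
        Pi\<^sub>E UNIV U \<subseteq> topspace (product_topology (\<lambda>_::int. discrete_topology S) UNIV) - X"
      using x(1) by (intro exI[of _ ?V]) (auto simp: PiE_iff)
  qed
  with S show "closedin (full_shift S) X"
    by (auto simp: closedin_def topspace_full_shift)
qed

lemma subshift_limit:
  "subshift S X \<Longrightarrow> (\<And>n::nat. \<exists>z\<in>X. \<forall>i. \<bar>i\<bar> \<le> int n \<longrightarrow> z i = x i) \<Longrightarrow> x \<in> X"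
  unfolding subshift_def closedin_full_shift_iff by blast

lemma subshift_range: "subshift S X \<Longrightarrow> x \<in> X \<Longrightarrow> x i \<in> S"
  unfolding subshift_def closedin_full_shift_iff by blast

lemma shift_map_power: "(shift_map ^^ j) x i = x (i + int j)"
  by (induction j arbitrary: i) (simp_all add: shift_map_def algebra_simps)

lemma shift_map_image_eq_translate:
  assumes "shift_map ` X = X" "x \<in> X"
  shows "(\<lambda>i. x (i + k)) \<in> X"
proof (induction k rule: int_induct[where k = 0])
  case base
  then show ?case using assms(2) by simp
next
  case (step1 k)
  then have "shift_map (\<lambda>i. x (i + k)) \<in> X" using assms(1) by blast
  then show ?case by (simp add: shift_map_def algebra_simps)
next
  case (step2 k)
  then obtain z where z: "z \<in> X" "(\<lambda>i. x (i + k)) = shift_map z" using assms(1) by blast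
  have "z i = x (i + (k - 1))" for i
    using fun_cong[OF z(2), of "i - 1"] by (simp add: shift_map_def algebra_simps)
  then have "z = (\<lambda>i. x (i + (k - 1)))" by blast
  then show ?case using z(1) by simp
qed

lemma shift_map_image_eqI:
  assumes "\<And>x k. x \<in> X \<Longrightarrow> (\<lambda>i. x (i + k)) \<in> X"
  shows "shift_map ` X = X"
proof
  show "shift_map ` X \<subseteq> X" using assms[of _ 1] by (auto simp: shift_map_def)
  show "X \<subseteq> shift_map ` X"
  proof
    fix x assume "x \<in> X"
    then have "(\<lambda>i. x (i + - 1)) \<in> X" by (rule assms)
    moreover have "x = shift_map (\<lambda>i. x (i + - 1))" by (simp add: shift_map_def)
    ultimately show "x \<in> shift_map ` X" by blast
  qed
qed

lemma subshift_translate: "subshift S X \<Longrightarrow> x \<in> X \<Longrightarrow> (\<lambda>i. x (i + k)) \<in> X"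
  unfolding subshift_def by (blast intro: shift_map_image_eq_translate)

lemma subshift_alphabet_mono:
  "subshift S X \<Longrightarrow> finite S' \<Longrightarrow> (\<And>x i. x \<in> X \<Longrightarrow> x i \<in> S') \<Longrightarrow> subshift S' X"
  unfolding subshift_def closedin_full_shift_iff by blast

lemma length_window [simp]: "length (window x k n) = n"
  by (simp add: window_def)

lemma nth_window [simp]: "i < n \<Longrightarrow> window x k n ! i = x (k + int i)"
  by (simp add: window_def)

lemma window_translate: "window (\<lambda>i. x (i + j)) k n = window x (k + j) n"
  by (simp add: window_def algebra_simps)

lemma window_eq_iff: "window x k n = window z l n \<longleftrightarrow> (\<forall>i<n. x (k + int i) = z (l + int i))"
  by (auto simp: list_eq_iff_nth_eq)

lemma window_add: "window x k (m + n) = window x k m @ window x (k + int m) n"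
  by (rule nth_equalityI) (auto simp: nth_append algebra_simps)

lemma window_take_drop: "a + n \<le> m \<Longrightarrow> window x (k + int a) n = take n (drop a (window x k m))"
  by (rule nth_equalityI) (auto simp: algebra_simps)

lemma window_eq_appendD:
  assumes "window x k n = ps @ w @ ss"
  shows "w = window x (k + int (length ps)) (length w)"
proof -
  have n: "n = length ps + (length w + length ss)"
    using arg_cong[OF assms, of length] by simp
  have "window x k n = window x k (length ps) @ window x (k + int (length ps)) (length w) @
      window x (k + int (length ps) + int (length w)) (length ss)"
    unfolding n window_add ..
  then show ?thesis using assms by (metis append_eq_append_conv length_window)
qed

lemma sublist_windowE:
  assumes "sublist w (window x k n)"
  obtains l where "window x l (length w) = w" "k \<le> l" "l + int (length w) \<le> k + int n"
proof -
  obtain ps ss where eq: "window x k n = ps @ w @ ss" using assms by (auto simp: sublist_def)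
  have "n = length ps + length w + length ss" using arg_cong[OF eq, of length] by simp
  with window_eq_appendD[OF eq] show thesis by (intro that[of "k + int (length ps)"]) auto
qed

lemma sublist_window:
  assumes "k \<le> l" "l + int m \<le> k + int n"
  shows "sublist (window x l m) (window x k n)"
proof -
  define a where "a = nat (l - k)"
  have "window x l m = take m (drop a (window x k n))"
    using window_take_drop[of a m n x k] assms by (simp add: a_def)
  then show ?thesis by (metis sublist_order.order_trans sublist_take sublist_drop)
qed

lemma window_in_language: "x \<in> X \<Longrightarrow> window x k n \<in> language X"
  unfolding language_def by blast

lemma in_language_iff: "w \<in> language X \<longleftrightarrow> (\<exists>x\<in>X. \<exists>k. window x k (length w) = w)"
proof
  assume "w \<in> language X"
  then obtain x k n where "x \<in> X" "w = window x k n" unfolding language_def by blast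
  then show "\<exists>x\<in>X. \<exists>k. window x k (length w) = w" by auto
next
  assume "\<exists>x\<in>X. \<exists>k. window x k (length w) = w"
  then obtain x k where "x \<in> X" "window x k (length w) = w" by blast
  with window_in_language[of x X k "length w"] show "w \<in> language X" by simp
qed

lemma language_sublist: "w \<in> language X \<Longrightarrow> sublist v w \<Longrightarrow> v \<in> language X"
  unfolding language_def by (auto elim!: sublist_windowE) (metis)

lemma language_letters: "subshift S X \<Longrightarrow> w \<in> language X \<Longrightarrow> set w \<subseteq> S"
  unfolding language_def window_def by (auto intro: subshift_range)

text \<open>
  A subshift is determined by its language: each central window of \<open>x\<close> is a window of a point of
  \<open>X\<close>, which can be translated so as to agree with \<open>x\<close> there, and \<open>X\<close> is closed.
\<close>

lemma subshift_language_imp_mem: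
  assumes X: "subshift S X" and x: "\<And>k n. window x k n \<in> language X"
  shows "x \<in> X"
proof (rule subshift_limit[OF X])
  fix n :: nat
  obtain z l where z: "z \<in> X" and eq: "window x (- int n) (2 * n + 1) = window z l (2 * n + 1)"
    using x[of "- int n" "2 * n + 1"] unfolding in_language_iff by (metis length_window)
  have "z (i + (l + int n)) = x i" if "\<bar>i\<bar> \<le> int n" for i
  proof -
    have "int (nat (i + int n)) = i + int n" "nat (i + int n) < 2 * n + 1" using that by linarith+
    then show ?thesis
      using eq[unfolded window_eq_iff, rule_format, of "nat (i + int n)"] by (simp add: algebra_simps)
  qed
  then show "\<exists>z\<in>X. \<forall>i. \<bar>i\<bar> \<le> int n \<longrightarrow> z i = x i"
    by (intro bexI[of _ "\<lambda>i. z (i + (l + int n))"] subshift_translate[OF X z]) simp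
qed

lemma compact_space_full_shift: "finite S \<Longrightarrow> compact_space (full_shift S)"
  unfolding full_shift_def by (simp add: compact_space_product_topology compact_space_discrete_topology)

lemma Hausdorff_space_full_shift: "Hausdorff_space (full_shift S)"
  unfolding full_shift_def by (simp add: Hausdorff_space_product_topology)

text \<open>
  If \<open>X\<close> were countable, it would be a countable union of singletons. None of them has interior when
  there are no isolated points, which contradicts the Baire category theorem for compact Hausdorff
  spaces.
\<close>

lemma uncountable_perfect_subshift:
  assumes X: "subshift S X" and ne: "X \<noteq> {}"
    and perfect: "\<And>x n. x \<in> X \<Longrightarrow> \<exists>z\<in>X. z \<noteq> x \<and> (\<forall>i. \<bar>i\<bar> \<le> int n \<longrightarrow> z i = x i)"
  shows "uncountable X"
proof
  assume count: "countable X"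
  define T where "T = subtopology (full_shift S) X"
  have cl: "closedin (full_shift S) X" and fin: "finite S" using X by (auto simp: subshift_def)
  have top: "topspace T = X" using closedin_subset[OF cl] by (auto simp: T_def)
  have "compact_space T" unfolding T_def
    using compact_space_full_shift[OF fin] cl closedin_compact_space compact_space_subtopology by blast
  moreover have H: "Hausdorff_space T" unfolding T_def
    by (simp add: Hausdorff_space_subtopology Hausdorff_space_full_shift)
  ultimately have lr: "locally_compact_space T \<and> regular_space T"
    using compact_imp_locally_compact_space compact_Hausdorff_imp_regular_space by blast
  have "T interior_of (\<Union>((\<lambda>x. {x}) ` X)) = {}"
  proof (rule Baire_category_alt[OF disjI2[OF lr]])
    show "countable ((\<lambda>x. {x}) ` X)" using count by simp
    fix A assume "A \<in> (\<lambda>x. {x}) ` X"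
    then obtain x where A: "A = {x}" and x: "x \<in> X" by blast
    have "x \<notin> T interior_of {x}"
    proof
      assume "x \<in> T interior_of {x}"
      then obtain U where "openin T U" "x \<in> U" "U \<subseteq> {x}" by (auto simp: interior_of_def)
      then obtain V where V: "openin (full_shift S) V" "x \<in> V" "V \<inter> X \<subseteq> {x}"
        by (auto simp: T_def openin_subtopology)
      from openin_full_shiftD[OF V(1,2)] obtain n :: nat where
        n: "\<And>z. range z \<subseteq> S \<Longrightarrow> (\<And>i. \<bar>i\<bar> \<le> int n \<Longrightarrow> z i = x i) \<Longrightarrow> z \<in> V" by blast
      obtain z where z: "z \<in> X" "z \<noteq> x" "\<forall>i. \<bar>i\<bar> \<le> int n \<longrightarrow> z i = x i" using perfect[OF x] by blast
      have "range z \<subseteq> S" using subshift_range[OF X z(1)] by blast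
      with n z have "z \<in> V" by blast
      with V(3) z show False by blast
    qed
    moreover have "T interior_of {x} \<subseteq> {x}" by (rule interior_of_subset)
    ultimately have "T interior_of {x} = {}" by blast
    moreover have "closedin T {x}"
      using Hausdorff_imp_t1_space[OF H] x top by (simp add: t1_space_closedin_singleton)
    ultimately show "closedin T A \<and> T interior_of A = {}" using A by simp
  qed
  moreover have "\<Union>((\<lambda>x. {x}) ` X) = topspace T" using top by auto
  ultimately show False using ne top interior_of_topspace[of T] by simp
qed


section \<open>Towers of words\<close>

lemma append_eq_append_ConsD:
  assumes "a @ b = ps @ h # ss" "h \<notin> set a"
  obtains c where "ps = a @ c" "b = c @ h # ss"
  using assms by (auto simp: append_eq_append_conv2 append_eq_Cons_conv)

lemma sublist_avoiding_letter:
  assumes "sublist w (a @ h # b)" "h \<notin> set w"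
  shows "sublist w a \<or> sublist w b"
proof -
  obtain ps ss where eq: "ps @ w @ ss = a @ h # b" using assms(1) by (auto simp: sublist_def)
  then consider c where "ps = a @ c" "c @ w @ ss = h # b"
    | c where "a = ps @ c" "w @ ss = c @ h # b"
    by (auto simp: append_eq_append_conv2)
  then show ?thesis
  proof cases
    case 1
    with assms(2) show ?thesis by (cases c; cases w) (auto simp: sublist_def)
  next
    case 2
    from 2(2) consider d where "w = c @ d" "d @ ss = h # b" | d where "c = w @ d"
      by (auto simp: append_eq_append_conv2)
    then show ?thesis
    proof cases
      case 1
      with assms(2) have "w = c" by (cases d) auto
      with 2(1) show ?thesis by simp
    next
      case 2
      with \<open>a = ps @ c\<close> show ?thesis by (auto simp: sublist_def)
    qed
  qed
qed

lemma suffix_of_shorter: "p @ v = a @ b \<Longrightarrow> length b \<le> length v \<Longrightarrow> \<exists>b'. v = b' @ b"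
  by (auto simp: append_eq_append_conv2)

lemma prefix_of_shorter: "v @ s = c @ d \<Longrightarrow> length c \<le> length v \<Longrightarrow> \<exists>c'. v = c @ c'"
  by (auto simp: append_eq_append_conv2)

text \<open>
  The common shape of all words of the tower: the letter \<open>h\<close> alternating with gap words.
\<close>

definition gap_list :: "'a \<Rightarrow> (nat \<Rightarrow> 'a list) \<Rightarrow> nat list \<Rightarrow> 'a list" where
  "gap_list h u ks = h # concat (map (\<lambda>k. u k @ [h]) ks)"

lemma gap_list_simps:
  "gap_list h u [] = [h]" "gap_list h u (k # ks) = h # u k @ gap_list h u ks"
  by (simp_all add: gap_list_def)

lemma gap_list_append: "gap_list h u ks @ u n @ gap_list h u ls = gap_list h u (ks @ n # ls)"
  by (induction ks) (simp_all add: gap_list_simps)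

text \<open>
  A word without \<open>h\<close> cannot extend across an \<open>h\<close>, so it stays within one gap.
\<close>

lemma sublist_gap_list_avoiding:
  assumes "sublist w (gap_list h u ks)" "h \<notin> set w"
  shows "w = [] \<or> (\<exists>k. sublist w (u k))"
  using assms(1)
proof (induction ks)
  case Nil
  with sublist_avoiding_letter[of w "[]" h "[]"] assms(2) show ?case by (simp add: gap_list_simps)
next
  case (Cons k ks)
  obtain v where v: "gap_list h u ks = h # v" by (simp add: gap_list_def)
  from Cons.prems have "sublist w ([] @ h # (u k @ h # v))" by (simp add: gap_list_simps v)
  from sublist_avoiding_letter[OF this assms(2)]
  have "w = [] \<or> sublist w (u k @ h # v)" by simp
  then consider "w = []" | "sublist w (u k)" | "sublist w v"
    using sublist_avoiding_letter[of w "u k" h v] assms(2) by blast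
  then show ?case
  proof cases
    case 3
    then have "sublist w (gap_list h u ks)" unfolding v by (simp add: sublist_Cons_right)
    then show ?thesis by (rule Cons.IH)
  qed auto
qed

lemma gap_list_gapD:
  assumes "gap_list h u ks = ps @ h # v @ h # ss" "h \<notin> set v" "\<And>k. h \<notin> set (u k)"
  shows "\<exists>k. v = u k"
  using assms(1)
proof (induction ks arbitrary: ps)
  case Nil
  then show ?case by (auto simp: gap_list_simps Cons_eq_append_conv)
next
  case (Cons k ks)
  obtain z where z: "gap_list h u ks = h # z" by (simp add: gap_list_def)
  show ?case
  proof (cases ps)
    case Nil
    with Cons.prems z have "u k @ h # z = v @ h # ss" by (simp add: gap_list_simps)
    then obtain c where c: "v = u k @ c" "h # z = c @ h # ss"
      using append_eq_append_ConsD assms(3) by metis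
    with assms(2) have "c = []" by (cases c) auto
    with c show ?thesis by auto
  next
    case (Cons b qs)
    with Cons.prems have "u k @ gap_list h u ks = qs @ h # v @ h # ss" by (auto simp: gap_list_simps)
    then obtain c where "gap_list h u ks = c @ h # v @ h # ss"
      using append_eq_append_ConsD assms(3) by metis
    then show ?thesis by (rule Cons.IH)
  qed
qed

text \<open>
  With three copies of the previous word there is one in the middle, so that the words extend each
  other in both directions around a fixed origin.
\<close>

primrec tower :: "'a \<Rightarrow> (nat \<Rightarrow> 'a list) \<Rightarrow> nat \<Rightarrow> 'a list" where
  "tower h u 0 = [h]"
| "tower h u (Suc n) = tower h u n @ u n @ tower h u n @ u n @ tower h u n"

definition tower_shift :: "'a \<Rightarrow> (nat \<Rightarrow> 'a list) \<Rightarrow> (int \<Rightarrow> 'a) set" where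
  "tower_shift h u = {x. \<forall>k n. \<exists>N. sublist (window x k n) (tower h u N)}"

lemma tower_eq_gap_list: "\<exists>ks. tower h u n = gap_list h u ks"
proof (induction n)
  case 0
  then show ?case by (metis gap_list_simps(1) tower.simps(1))
next
  case (Suc n)
  then show ?case by (auto simp: gap_list_append)
qed

lemma sublist_tower_mono: "m \<le> n \<Longrightarrow> sublist (tower h u m) (tower h u n)"
proof (induction n rule: dec_induct)
  case (step n)
  have "sublist (tower h u n) (tower h u (Suc n))" by simp
  with step.IH show ?case by (rule sublist_order.order_trans)
qed simp

text \<open>
  Every occurrence of \<open>h\<close> in \<open>w\<close> is part of an occurrence of \<open>T\<close> in \<open>w\<close>.
\<close>

definition covered_by :: "'a list \<Rightarrow> 'a \<Rightarrow> 'a list \<Rightarrow> bool" where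
  "covered_by T h w \<longleftrightarrow> (\<forall>ps ss. w = ps @ h # ss \<longrightarrow>
    (\<exists>a b c d. ps = a @ b \<and> ss = c @ d \<and> b @ h # c = T))"

lemma covered_by_append:
  assumes "covered_by T h v" "covered_by T h w"
  shows "covered_by T h (v @ w)"
  unfolding covered_by_def
proof (intro allI impI)
  fix ps ss assume "v @ w = ps @ h # ss"
  then consider c where "v = ps @ h # c" "ss = c @ w" | c where "ps = v @ c" "w = c @ h # ss"
    by (auto simp: append_eq_append_conv2 append_eq_Cons_conv)
  then show "\<exists>a b c d. ps = a @ b \<and> ss = c @ d \<and> b @ h # c = T"
  proof cases
    case 1
    with assms(1) show ?thesis unfolding covered_by_def by (metis append.assoc)
  next
    case 2
    with assms(2) show ?thesis unfolding covered_by_def by (metis append.assoc)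
  qed
qed

lemma covered_by_avoiding: "h \<notin> set w \<Longrightarrow> covered_by T h w"
  by (auto simp: covered_by_def)

lemma covered_by_self: "covered_by T h T"
  unfolding covered_by_def by (metis append.right_neutral append_Nil)

lemma infinite_int_aboveI:
  fixes A :: "int set"
  assumes "\<And>m::nat. \<exists>k\<in>A. int m \<le> k"
  shows "infinite A"
proof
  assume fin: "finite A"
  obtain k where "k \<in> A" "int (nat (Max A + 1)) \<le> k" using assms by blast
  with Max_ge[OF fin, of k] show False by (auto split: if_splits)
qed

lemma infinite_int_belowI:
  fixes A :: "int set"
  assumes "\<And>m::nat. \<exists>k\<in>A. k \<le> - int m"
  shows "infinite A"
proof -
  have "infinite (uminus ` A)"
  proof (rule infinite_int_aboveI)
    fix m
    obtain k where "k \<in> A" "k \<le> - int m" using assms by blast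
    then show "\<exists>l\<in>uminus ` A. int m \<le> l" by (intro bexI[of _ "- k"]) auto
  qed
  then show ?thesis by blast
qed

text \<open>
  The gap words are arbitrary apart from being words of \<open>Y\<close> of unbounded length; which words occur
  as gaps does not affect the dynamics, and this is the freedom used for coding.
\<close>

locale word_tower =
  fixes S :: "'a set" and Y :: "(int \<Rightarrow> 'a) set" and h :: 'a and u :: "nat \<Rightarrow> 'a list"
  assumes minimal: "minimal_subshift S Y" and nonempty: "Y \<noteq> {}" and fresh: "h \<notin> S"
    and gaps: "\<And>n. u n \<in> language Y" and unbounded: "\<And>b. \<exists>n. b \<le> length (u n)"
begin

abbreviation "T \<equiv> tower h u"
abbreviation "X \<equiv> tower_shift h u"

lemma Y: "subshift S Y"
  using minimal by (simp add: minimal_subshift_def)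

lemma gap_letters: "set (u n) \<subseteq> S"
  by (rule language_letters[OF Y gaps])

lemma gap_avoids: "h \<notin> set (u n)"
  using gap_letters fresh by blast

lemma tower_letters: "set (T n) \<subseteq> insert h S"
  using gap_letters by (induction n) auto

lemma tower_covered: "n \<le> m \<Longrightarrow> covered_by (T n) h (T m)"
  by (induction m rule: dec_induct)
     (auto intro!: covered_by_append intro: covered_by_self covered_by_avoiding[OF gap_avoids])

lemma tower_shift_letters: "x \<in> X \<Longrightarrow> x i \<in> insert h S"
proof -
  assume "x \<in> X"
  then obtain N where "sublist (window x i 1) (T N)" by (auto simp: tower_shift_def)
  then have "set (window x i 1) \<subseteq> insert h S" using tower_letters set_mono_sublist by blast
  then show ?thesis by (simp add: window_def)
qed

lemma subshift_tower: "subshift (insert h S) X"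
  unfolding subshift_def closedin_full_shift_iff
proof (intro conjI ballI allI impI)
  show "finite (insert h S)" using Y by (simp add: subshift_def)
  show "range x \<subseteq> insert h S" if "x \<in> X" for x using tower_shift_letters[OF that] by blast
  show "shift_map ` X = X"
    by (rule shift_map_image_eqI) (simp add: tower_shift_def window_translate)
  show "x \<in> X" if lim: "\<forall>n. \<exists>z\<in>X. \<forall>i. \<bar>i\<bar> \<le> int n \<longrightarrow> z i = x i" for x
    unfolding tower_shift_def
  proof (clarify)
    fix k n
    obtain z where z: "z \<in> X" "\<forall>i. \<bar>i\<bar> \<le> int (nat \<bar>k\<bar> + n) \<longrightarrow> z i = x i" using lim by blast
    then have "window x k n = window z k n" by (auto simp: window_eq_iff)
    with z(1) show "\<exists>N. sublist (window x k n) (T N)" by (simp add: tower_shift_def)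
  qed
qed

text \<open>
  The words \<open>T n\<close>, placed with their middle letter at the origin, extend each other and so define a
  point; \<open>radius n\<close> is the number of letters of \<open>T n\<close> on either side of the middle.
\<close>

primrec radius :: "nat \<Rightarrow> nat" where
  "radius 0 = 0"
| "radius (Suc n) = radius n + length (u n) + length (T n)"

lemma length_tower: "length (T n) = 2 * radius n + 1"
  by (induction n) auto

lemma radius_ge: "n \<le> radius n"
  by (induction n) (auto simp: length_tower)

definition centre :: "int \<Rightarrow> 'a" where
  "centre i = T (nat \<bar>i\<bar>) ! nat (i + int (radius (nat \<bar>i\<bar>)))"

text \<open>
  The middle copy of \<open>T n\<close> in \<open>T (Suc n)\<close> begins after \<open>T n\<close> and one gap, exactly the amount by which
  the radius grows.
\<close>

lemma tower_nth_eq: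
  assumes "\<bar>i\<bar> \<le> int (radius m)" "m \<le> n"
  shows "T n ! nat (i + int (radius n)) = T m ! nat (i + int (radius m))"
  using assms(2)
proof (induction n rule: dec_induct)
  case (step n)
  have mono: "radius m \<le> radius n" using step.hyps(1) by (induction n rule: dec_induct) auto
  have "nat (i + int (radius (Suc n))) = length (T n) + (length (u n) + nat (i + int (radius n)))"
    using assms(1) mono by simp
  moreover have "nat (i + int (radius n)) < length (T n)"
    using assms(1) mono by (simp add: length_tower)
  ultimately have "T (Suc n) ! nat (i + int (radius (Suc n))) = T n ! nat (i + int (radius n))"
    by (simp add: nth_append)
  with step.IH show ?case by simp
qed simp

lemma centre_eq: "\<bar>i\<bar> \<le> int (radius n) \<Longrightarrow> centre i = T n ! nat (i + int (radius n))"
proof -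
  assume i: "\<bar>i\<bar> \<le> int (radius n)"
  have "\<bar>i\<bar> \<le> int (radius (nat \<bar>i\<bar>))" using radius_ge[of "nat \<bar>i\<bar>"] by linarith
  with i show ?thesis unfolding centre_def
    using tower_nth_eq[of i n "nat \<bar>i\<bar>"] tower_nth_eq[of i "nat \<bar>i\<bar>" n]
    by (cases "n \<le> nat \<bar>i\<bar>") auto
qed

lemma window_centre: "window centre (- int (radius n)) (length (T n)) = T n"
proof (rule nth_equalityI)
  fix i assume "i < length (window centre (- int (radius n)) (length (T n)))"
  then have i: "i < length (T n)" by simp
  then have "centre (- int (radius n) + int i) = T n ! nat (- int (radius n) + int i + int (radius n))"
    by (intro centre_eq) (simp add: length_tower)
  with i show "window centre (- int (radius n)) (length (T n)) ! i = T n ! i" by simp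
qed simp

lemma centre_in: "centre \<in> X"
  unfolding tower_shift_def
proof clarify
  fix k n
  define N where "N = nat \<bar>k\<bar> + n"
  have "sublist (window centre k n) (window centre (- int (radius N)) (length (T N)))"
    by (rule sublist_window) (use radius_ge[of N] in \<open>auto simp: N_def length_tower\<close>)
  then show "\<exists>N. sublist (window centre k n) (T N)" unfolding window_centre ..
qed

lemma language_tower_shift: "w \<in> language X \<longleftrightarrow> (\<exists>N. sublist w (T N))"
proof
  assume "w \<in> language X"
  then show "\<exists>N. sublist w (T N)" by (auto simp: in_language_iff tower_shift_def) metis
next
  assume "\<exists>N. sublist w (T N)"
  then obtain N where "sublist w (T N)" ..
  moreover have "T N \<in> language X" using window_in_language[OF centre_in] window_centre by metis
  ultimately show "w \<in> language X" by (rule language_sublist[rotated])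
qed

text \<open>
  The outer copies of \<open>T m\<close> in \<open>T (Suc m)\<close> lie beyond the middle copy, hence at distance at least
  \<open>radius m\<close> from the origin.
\<close>

lemma centre_recurrent:
  assumes "sublist w (T n)" "n \<le> m"
  obtains k l where "window centre k (length w) = w" "int m \<le> k"
    "window centre l (length w) = w" "l \<le> - int m"
proof -
  have eq: "window centre (- int (radius (Suc m))) (length (T (Suc m))) = [] @ T m @ (u m @ T m @ u m @ T m)"
    "window centre (- int (radius (Suc m))) (length (T (Suc m))) = (T m @ u m @ T m @ u m) @ T m @ []"
    unfolding window_centre by simp_all
  have left: "T m = window centre (- int (radius (Suc m))) (length (T m))"
    using window_eq_appendD[OF eq(1)] by (simp only: list.size of_nat_0 add_0_right)
  have right: "T m = window centre (- int (radius (Suc m)) +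
      int (length (T m @ u m @ T m @ u m))) (length (T m))"
    by (rule window_eq_appendD[OF eq(2)])
  have sub: "sublist w (T m)"
    by (rule sublist_order.order_trans[OF assms(1) sublist_tower_mono[OF assms(2)]])
  have "sublist w (window centre (- int (radius (Suc m))) (length (T m)))"
    using sub by (simp only: left[symmetric])
  then obtain l where l: "window centre l (length w) = w"
    "l + int (length w) \<le> - int (radius (Suc m)) + int (length (T m))"
    by (rule sublist_windowE)
  have "sublist w (window centre (- int (radius (Suc m)) +
      int (length (T m @ u m @ T m @ u m))) (length (T m)))"
    using sub by (simp only: right[symmetric])
  then obtain k where k: "window centre k (length w) = w"
    "- int (radius (Suc m)) + int (length (T m @ u m @ T m @ u m)) \<le> k"
    by (rule sublist_windowE)
  show thesis
    using k l radius_ge[of m] by (intro that[of k l]) (auto simp: length_tower)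
qed

lemma transitive_tower: "transitive_subshift (insert h S) X"
  unfolding transitive_subshift_def
proof (intro conjI subshift_tower bexI[OF _ centre_in] ballI)
  fix w assume "w \<in> language X"
  then obtain n where n: "sublist w (T n)" using language_tower_shift by blast
  have *: "\<exists>k l. window centre k (length w) = w \<and> int m \<le> k \<and> window centre l (length w) = w \<and> l \<le> - int m" for m
  proof -
    from centre_recurrent[OF n le_add1] obtain k l where "window centre k (length w) = w" "int (n + m) \<le> k"
      "window centre l (length w) = w" "l \<le> - int (n + m)" .
    then show ?thesis by (intro exI[of _ k] exI[of _ l]) simp
  qed
  show "infinite {k. k < 0 \<and> window centre k (length w) = w}"
  proof (rule infinite_int_belowI)
    fix m
    obtain l where "window centre l (length w) = w" "l \<le> - int (m + 1)" using * by blast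
    then show "\<exists>l\<in>{k. k < 0 \<and> window centre k (length w) = w}. l \<le> - int m"
      by (intro bexI[of _ l]) auto
  qed
  show "infinite {k. k \<ge> 0 \<and> window centre k (length w) = w}"
  proof (rule infinite_int_aboveI)
    fix m
    obtain k where "window centre k (length w) = w" "int m \<le> k" using * by blast
    then show "\<exists>k\<in>{k. k \<ge> 0 \<and> window centre k (length w) = w}. int m \<le> k"
      by (intro bexI[of _ k]) auto
  qed
qed

text \<open>
  Around an \<open>h\<close> take a window that reaches \<open>length (T n)\<close> letters to either side. It occurs in \<open>T m\<close> for
  some \<open>m \<ge> n\<close>, where the \<open>h\<close> belongs to a copy of \<open>T n\<close>; that copy fits into the window.
\<close>

lemma dense_orbit:
  assumes "x \<in> X" "x i = h" "w \<in> language X"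
  shows "\<exists>k. window x k (length w) = w"
proof -
  obtain n where n: "sublist w (T n)" using assms(3) language_tower_shift by blast
  define L where "L = length (T n)"
  obtain m' where "sublist (window x (i - int L) (2 * L + 1)) (T m')"
    using assms(1) by (auto simp: tower_shift_def)
  then have "sublist (window x (i - int L) (2 * L + 1)) (T (max n m'))"
    by (rule sublist_order.order_trans) (simp add: sublist_tower_mono)
  then obtain p s where T: "T (max n m') = p @ window x (i - int L) (2 * L + 1) @ s"
    by (auto simp: sublist_def)
  have win: "window x (i - int L) (2 * L + 1) = window x (i - int L) L @ h # window x (i + 1) L"
  proof -
    have "2 * L + 1 = L + (1 + L)" by simp
    moreover have "window x j 1 = [x j]" for j by (simp add: window_def)
    ultimately show ?thesis by (simp only: window_add) (simp add: assms(2))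
  qed
  from T have T': "T (max n m') = (p @ window x (i - int L) L) @ h # (window x (i + 1) L @ s)"
    unfolding win by simp
  from tower_covered[of n "max n m'"] T' obtain a b c d where
    abcd: "p @ window x (i - int L) L = a @ b" "window x (i + 1) L @ s = c @ d" "b @ h # c = T n"
    unfolding covered_by_def by (metis max.cobounded1)
  from abcd(3) have "length b \<le> L" "length c \<le> L" unfolding L_def by (auto dest!: arg_cong[of _ _ length])
  then obtain b' c' where "window x (i - int L) L = b' @ b" "window x (i + 1) L = c @ c'"
    using suffix_of_shorter[OF abcd(1)] prefix_of_shorter[OF abcd(2)] by auto
  then have "window x (i - int L) (2 * L + 1) = b' @ T n @ c'"
    unfolding win abcd(3)[symmetric] by simp
  then have "sublist (T n) (window x (i - int L) (2 * L + 1))" by (auto simp: sublist_def)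
  with n have "sublist w (window x (i - int L) (2 * L + 1))" by (rule sublist_order.order_trans)
  then show ?thesis by (metis sublist_windowE)
qed

text \<open>
  The points avoiding \<open>h\<close> form a subsystem of \<open>Y\<close>, as their windows lie inside gaps. It is nonempty:
  centring long gaps at the origin gives points of \<open>X\<close> that avoid \<open>h\<close> on \<open>[-n, n]\<close> for each \<open>n\<close>, and
  compactness gives one for all \<open>n\<close>. Minimality does the rest.
\<close>

lemma Y_eq: "{x \<in> X. h \<notin> range x} = Y"
proof -
  let ?Z = "{x \<in> X. h \<notin> range x}"
  have "subshift S ?Z"
    unfolding subshift_def closedin_full_shift_iff
  proof (intro conjI ballI allI impI)
    show "finite S" using Y by (simp add: subshift_def)
    show "range x \<subseteq> S" if "x \<in> ?Z" for x
    proof clarify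
      fix i
      have "x i \<noteq> h" using that rangeI[of x i] by auto
      then show "x i \<in> S" using tower_shift_letters[of x i] that by blast
    qed
    show "shift_map ` ?Z = ?Z"
      by (rule shift_map_image_eqI) (use subshift_translate[OF subshift_tower] in auto)
    show "x \<in> ?Z" if lim: "\<forall>n. \<exists>z\<in>?Z. \<forall>i. \<bar>i\<bar> \<le> int n \<longrightarrow> z i = x i" for x
    proof -
      have "x \<in> X" using lim by (intro subshift_limit[OF subshift_tower]) blast
      moreover have "x i \<noteq> h" for i
      proof -
        obtain z where z: "z \<in> ?Z" "\<forall>j. \<bar>j\<bar> \<le> int (nat \<bar>i\<bar>) \<longrightarrow> z j = x j" using lim by blast
        then have "z i = x i" by simp
        then show ?thesis using z(1) rangeI[of z i] by auto
      qed
      ultimately show ?thesis by auto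
    qed
  qed
  moreover have "?Z \<subseteq> Y"
  proof clarify
    fix x assume x: "x \<in> X" "h \<notin> range x"
    show "x \<in> Y"
    proof (rule subshift_language_imp_mem[OF Y])
      fix k n
      obtain N where "sublist (window x k n) (T N)" using x(1) by (auto simp: tower_shift_def)
      moreover obtain ks where "T N = gap_list h u ks" using tower_eq_gap_list[of h u N] by blast
      moreover have "h \<notin> set (window x k n)" using x(2) by (auto simp: window_def)
      ultimately have "window x k n = [] \<or> (\<exists>j. sublist (window x k n) (u j))"
        using sublist_gap_list_avoiding by metis
      then have "\<exists>j. sublist (window x k n) (u j)" by auto
      then show "window x k n \<in> language Y" using gaps language_sublist by blast
    qed
  qed
  moreover have "?Z \<noteq> {}"
  proof -
    define F where "F n = {x \<in> X. \<forall>i. \<bar>i\<bar> \<le> int n \<longrightarrow> x i \<noteq> h}" for n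
    have "(\<Inter>n. F n) \<noteq> {}"
    proof (rule compact_space_imp_nest)
      show "compact_space (full_shift (insert h S))"
        using Y by (intro compact_space_full_shift) (simp add: subshift_def)
      show "decseq F"
        unfolding decseq_def
      proof (intro allI impI subsetI)
        fix m n x assume "m \<le> n" "x \<in> F n"
        then show "x \<in> F m" by (simp add: F_def)
      qed
      show "closedin (full_shift (insert h S)) (F n)" for n
        unfolding closedin_full_shift_iff
      proof (intro conjI ballI allI impI)
        show "range x \<subseteq> insert h S" if "x \<in> F n" for x
          using that tower_shift_letters[of x] by (auto simp: F_def)
        show "x \<in> F n" if lim: "\<forall>m. \<exists>z\<in>F n. \<forall>i. \<bar>i\<bar> \<le> int m \<longrightarrow> z i = x i" for x
        proof -
          have "x \<in> X"
            using lim by (intro subshift_limit[OF subshift_tower]) (auto simp: F_def, blast)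
          moreover obtain z where "z \<in> F n" "\<forall>i. \<bar>i\<bar> \<le> int n \<longrightarrow> z i = x i" using lim by blast
          ultimately show ?thesis by (auto simp: F_def)
        qed
      qed
      show "F n \<noteq> {}" for n
      proof -
        obtain k where k: "2 * n + 1 \<le> length (u k)" using unbounded by blast
        have "window centre (- int (radius (Suc k))) (length (T (Suc k))) =
            T k @ u k @ T k @ u k @ T k" unfolding window_centre by simp
        from window_eq_appendD[OF this] obtain p where p: "u k = window centre p (length (u k))" by metis
        let ?x = "\<lambda>i. centre (i + (p + int n))"
        have "?x i \<noteq> h" if "\<bar>i\<bar> \<le> int n" for i
        proof -
          have j: "int (nat (i + int n)) = i + int n" "nat (i + int n) < length (u k)"
            using that k by linarith+
          have "?x i = u k ! nat (i + int n)"
            using j by (subst p) (simp add: algebra_simps)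
          moreover have "u k ! nat (i + int n) \<in> set (u k)" using j(2) by (rule nth_mem)
          ultimately show ?thesis using gap_avoids by metis
        qed
        then have "?x \<in> F n" using subshift_translate[OF subshift_tower centre_in] by (simp add: F_def)
        then show ?thesis by blast
      qed
    qed
    then obtain x where x: "\<And>n. x \<in> F n" by blast
    have "x i \<noteq> h" for i using x[of "nat \<bar>i\<bar>"] by (simp add: F_def)
    moreover have "x \<in> X" using x[of 0] by (simp add: F_def)
    ultimately have "x \<in> ?Z" by auto
    then show ?thesis by blast
  qed
  ultimately show ?thesis
    using minimal unfolding minimal_subshift_def subsystem_def by metis
qed

text \<open>
  If \<open>h\<close> occurs in some point of \<open>Z\<close>, the orbit of that point is dense and \<open>Z = X\<close>. Otherwise \<open>Z\<close> is
  contained in the minimal subshift \<open>Y\<close>.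
\<close>

lemma subsystem_cases:
  assumes "subsystem (insert h S) Z X"
  shows "Z = {} \<or> Z = Y \<or> Z = X"
proof (cases "\<exists>z\<in>Z. h \<in> range z")
  case True
  have Z: "subshift (insert h S) Z" "Z \<subseteq> X" using assms by (auto simp: subsystem_def)
  from True obtain z i where z: "z \<in> Z" "z i = h" by auto
  have "X \<subseteq> Z"
  proof
    fix x assume x: "x \<in> X"
    show "x \<in> Z"
    proof (rule subshift_language_imp_mem[OF Z(1)])
      fix k n
      have "window x k n \<in> language X" using x by (rule window_in_language)
      from dense_orbit[where x = z, OF _ z(2) this] z(1) Z(2) obtain l where "window z l n = window x k n" by auto
      then show "window x k n \<in> language Z" using window_in_language[OF z(1)] by metis
    qed
  qed
  with Z(2) show ?thesis by blast
next
  case False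
  with assms have "Z \<subseteq> Y" unfolding Y_eq[symmetric] by (auto simp: subsystem_def)
  moreover have "subshift S Z"
  proof (rule subshift_alphabet_mono[of "insert h S"])
    show "subshift (insert h S) Z" using assms by (simp add: subsystem_def)
    show "finite S" using Y by (simp add: subshift_def)
    show "x i \<in> S" if "x \<in> Z" for x i using that \<open>Z \<subseteq> Y\<close> by (intro subshift_range[OF Y]) blast
  qed
  ultimately show ?thesis using minimal unfolding minimal_subshift_def subsystem_def by blast
qed

lemma subsystem_Y: "subsystem (insert h S) Y X"
proof -
  have "finite (insert h S)" using Y by (simp add: subshift_def)
  then have "subshift (insert h S) Y"
    using subshift_alphabet_mono[OF Y] subshift_range[OF Y] by blast
  then show ?thesis using Y_eq by (auto simp: subsystem_def)
qed

lemma centre_0: "centre 0 = h"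
  using centre_eq[of 0 0] by simp

lemma Y_neq: "Y \<noteq> X"
proof -
  have "h \<in> range centre" by (metis centre_0 rangeI)
  then have "centre \<notin> Y" unfolding Y_eq[symmetric] by blast
  then show ?thesis using centre_in by blast
qed

lemma nontrivial_subsystems: "{Z. nontrivial_subsystem (insert h S) Z X} = {Y}"
  using subsystem_cases subsystem_Y Y_neq nonempty by (auto simp: nontrivial_subsystem_def)

lemma quasiminimal_tower: "quasiminimal_subshift (insert h S) X"
proof -
  have "{Z. subsystem (insert h S) Z X \<and> Z \<noteq> X} \<subseteq> {{}, Y}" using subsystem_cases by auto
  then show ?thesis unfolding quasiminimal_subshift_def
    using subshift_tower finite_subset by blast
qed

text \<open>
  With a period \<open>p\<close>, every window of length \<open>p\<close> would contain \<open>h\<close>, as the origin carries \<open>h\<close>. But a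
  window of length \<open>p\<close> of a point of \<open>Y\<close> occurs in \<open>centre\<close>.
\<close>

lemma centre_not_periodic:
  assumes "0 < p"
  shows "\<exists>i. centre (i + int p) \<noteq> centre i"
proof (rule ccontr)
  assume "\<not> ?thesis"
  then have per: "centre (i + int p) = centre i" for i by blast
  have h: "centre (int p * k) = h" for k
  proof (induction k rule: int_induct[where k = 0])
    case (step1 k)
    then show ?case using per[of "int p * k"] by (simp add: algebra_simps)
  next
    case (step2 k)
    then show ?case using per[of "int p * (k - 1)"] by (simp add: algebra_simps)
  qed (simp add: centre_0)
  obtain y where y: "y \<in> Y" using nonempty by blast
  have "window y 0 p \<in> language X"
    using y Y_eq by (intro window_in_language) blast
  from dense_orbit[OF centre_in centre_0 this] obtain k where k: "window centre k p = window y 0 p" by auto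
  define i where "i = nat ((- k) mod int p)"
  have i: "i < p" "int i = (- k) mod int p" using assms by (auto simp: i_def nat_less_iff)
  have "(k + int i) mod int p = 0" unfolding i(2) by (simp add: mod_simps)
  then have "int p dvd k + int i" by (simp add: mod_eq_0_iff_dvd)
  then obtain q where "k + int i = int p * q" by (rule dvdE)
  with h have "centre (k + int i) = h" by simp
  with k i(1) have "y (int i) = h" by (simp add: window_eq_iff)
  with y Y_eq show False by auto
qed

text \<open>
  The central window of a point occurs at two places of \<open>centre\<close>. The two corresponding translates are
  distinct, since \<open>centre\<close> is not periodic, so one of them differs from the given point.
\<close>

lemma uncountable_tower: "uncountable X"
proof (rule uncountable_perfect_subshift[OF subshift_tower])
  show "X \<noteq> {}" using centre_in by blast
next
  fix x and n :: nat assume x: "x \<in> X"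
  define w where "w = window x (- int n) (2 * n + 1)"
  have "w \<in> language X" unfolding w_def using x by (rule window_in_language)
  then obtain N where N: "sublist w (T N)" using language_tower_shift by blast
  obtain k where k: "window centre k (length w) = w" "int N \<le> k"
    using centre_recurrent[OF N order_refl] by metis
  obtain l where l: "window centre l (length w) = w" "int (N + nat k + 1) \<le> l"
    using centre_recurrent[OF N, of "N + nat k + 1"] by (metis add.assoc le_add1)
  have less: "k < l" using k(2) l(2) by simp
  let ?z = "\<lambda>j i. centre (i + (j + int n))"
  have agree: "?z j i = x i" if "window centre j (length w) = w" "\<bar>i\<bar> \<le> int n" for j i
  proof -
    have eq: "window centre j (2 * n + 1) = window x (- int n) (2 * n + 1)"
      using that(1) by (simp add: w_def)
    have "int (nat (i + int n)) = i + int n" "nat (i + int n) < 2 * n + 1"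
      using that(2) by linarith+
    then show ?thesis
      using eq[unfolded window_eq_iff, rule_format, of "nat (i + int n)"] by (simp add: algebra_simps)
  qed
  have "?z k \<noteq> ?z l"
  proof
    assume eq: "?z k = ?z l"
    have "centre (i + int (nat (l - k))) = centre i" for i
      using fun_cong[OF eq, of "i - (k + int n)"] less by (simp add: algebra_simps)
    then show False using centre_not_periodic[of "nat (l - k)"] less by simp
  qed
  then obtain j where j: "window centre j (length w) = w" "?z j \<noteq> x"
    using k(1) l(1) by (cases "?z k = x") auto
  have "?z j \<in> X" by (rule subshift_translate[OF subshift_tower centre_in])
  then show "\<exists>z\<in>X. z \<noteq> x \<and> (\<forall>i. \<bar>i\<bar> \<le> int n \<longrightarrow> z i = x i)"
    by (rule bexI[rotated]) (use j(2) agree[OF j(1)] in simp)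
qed

end

section \<open>The halting problem of a recursive tower\<close>

lemma recursive_list_tower [recursive_intros]:
  assumes u: "recursive_list u" and a: "recursive_fun a"
  shows "recursive_list (\<lambda>x. tower h u (a x))"
proof -
  have "recursive_list (\<lambda>z. u (pfst z))"
    by (rule recursive_list_comp[OF u]) (intro recursive_intros)
  then have "recursive_fun (\<lambda>x. rec_nat (list_encode [h])
      (\<lambda>n y. list_encode (list_decode y @ u n @ list_decode y @ u n @ list_decode y)) (a x))"
    by (intro recursive_intros a)
  moreover have "rec_nat (list_encode [h])
      (\<lambda>n y. list_encode (list_decode y @ u n @ list_decode y @ u n @ list_decode y)) n =
      list_encode (tower h u n)" for n
    by (induction n) simp_all
  ultimately show ?thesis unfolding recursive_list_def by simp
qed

definition pres_decode :: "nat \<Rightarrow> nat clopen_pres" where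
  "pres_decode z = (int_decode (pfst z), pfst (psnd z), map list_decode (list_decode (psnd (psnd z))))"

lemma pres_decode_encode [simp]: "pres_decode (pres_encode c) = c"
  by (cases c) (simp add: pres_decode_def pres_encode_def comp_def)

lemma pres_encode_decode [simp]: "pres_encode (pres_decode z) = z"
  by (simp add: pres_decode_def pres_encode_def comp_def)

lemma halting_problem_iff:
  "z \<in> halting_problem S X \<longleftrightarrow>
    valid_pres S (pres_decode (pfst z)) \<and> valid_pres S (pres_decode (pfst (psnd z))) \<and>
    valid_pres S (pres_decode (psnd (psnd z))) \<and>
    halts_along X (clopen_of (pres_decode (pfst z))) (clopen_of (pres_decode (pfst (psnd z))))
      (clopen_of (pres_decode (psnd (psnd z))))"
proof
  assume "z \<in> halting_problem S X"
  then show "valid_pres S (pres_decode (pfst z)) \<and> valid_pres S (pres_decode (pfst (psnd z))) \<and>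
    valid_pres S (pres_decode (psnd (psnd z))) \<and>
    halts_along X (clopen_of (pres_decode (pfst z))) (clopen_of (pres_decode (pfst (psnd z))))
      (clopen_of (pres_decode (psnd (psnd z))))"
    unfolding halting_problem_def by auto
next
  have z: "z = prod_encode (pres_encode (pres_decode (pfst z)),
      prod_encode (pres_encode (pres_decode (pfst (psnd z))), pres_encode (pres_decode (psnd (psnd z)))))"
    by simp
  assume "valid_pres S (pres_decode (pfst z)) \<and> valid_pres S (pres_decode (pfst (psnd z))) \<and>
    valid_pres S (pres_decode (psnd (psnd z))) \<and>
    halts_along X (clopen_of (pres_decode (pfst z))) (clopen_of (pres_decode (pfst (psnd z))))
      (clopen_of (pres_decode (psnd (psnd z))))"
  with z show "z \<in> halting_problem S X" unfolding halting_problem_def by blast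
qed

lemma recursive_pred_valid_pres [recursive_intros]:
  assumes "finite S" "recursive_fun a"
  shows "recursive_pred (\<lambda>x. valid_pres S (pres_decode (a x)))"
proof -
  have "recursive_pred (\<lambda>z. \<forall>v\<in>set (list_decode (psnd (psnd z))).
      (\<forall>b\<in>set (list_decode v). b \<in> S) \<and> length (list_decode v) = pfst (psnd z))"
    by (intro recursive_intros recursive_pred_mem_finite[OF assms(1)])
  then have "recursive_pred (\<lambda>z. valid_pres S (pres_decode z))"
    unfolding valid_pres_def pres_decode_def by (simp add: in_lists_conv_set)
  then show ?thesis by (rule recursive_pred_comp[OF _ assms(2)])
qed

text \<open>
  The condition of the presentation, evaluated in a finite word \<open>w\<close> with the origin at position \<open>p\<close>.
  That \<open>v\<close> occurs at position \<open>q\<close> is phrased through \<^const>\<open>drop\<close> and append, both of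
  them recursive operations on coded lists.
\<close>

definition occurs_at :: "'a clopen_pres \<Rightarrow> 'a list \<Rightarrow> nat \<Rightarrow> bool" where
  "occurs_at = (\<lambda>(k, n, ws) w p. \<exists>q. int q = int p + k \<and>
    (\<exists>v\<in>set ws. drop q w = v @ drop (q + length v) w))"

lemma occurs_atD:
  assumes "occurs_at c w p" "valid_pres S c" "window x l (length w) = w"
  shows "(\<lambda>i. x (i + (l + int p))) \<in> clopen_of c"
proof -
  obtain k n ws where c: "c = (k, n, ws)" by (cases c)
  obtain q v where q: "int q = int p + k" and v: "v \<in> set ws" "drop q w = v @ drop (q + length v) w"
    using assms(1) unfolding c occurs_at_def by auto
  have n: "length v = n" using assms(2) v(1) unfolding c valid_pres_def by auto
  have "v = window x (l + int q) (length v)"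
  proof (cases "q \<le> length w")
    case True
    have "window x l (length w) = take q w @ v @ drop (q + length v) w"
      unfolding assms(3) v(2)[symmetric] by simp
    from window_eq_appendD[OF this] True show ?thesis by simp
  next
    case False
    then have "v = []" using v(2) by simp
    then show ?thesis by (simp add: window_def)
  qed
  with v(1) n q show ?thesis unfolding c clopen_of_def
    by (simp add: window_translate algebra_simps)
qed

text \<open>
  The bound on \<open>m\<close> keeps all coordinates that the presentation inspects inside the central window.
\<close>

lemma occurs_atI:
  assumes w: "w = a @ window x (- int m) (2 * m + 1) @ b"
    and x: "(\<lambda>i. x (i + int t)) \<in> clopen_of (k, n, ws)"
    and m: "nat \<bar>k\<bar> + n + t \<le> m"
  shows "occurs_at (k, n, ws) w (length a + m + t)"
proof -
  define d where "d = nat (int m + int t + k)"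
  have d: "int d = int m + int t + k" using m by (simp add: d_def)
  define W where "W = window x (- int m) (2 * m + 1)"
  define v where "v = window x (int t + k) n"
  have dn: "d + n \<le> 2 * m + 1" using d m by linarith
  have v: "v \<in> set ws" using x by (simp add: clopen_of_def window_translate v_def algebra_simps)
  have lW: "length W = 2 * m + 1" by (simp add: W_def)
  have "v = take n (drop d W)"
    using window_take_drop[OF dn, of x "- int m"] d by (simp add: v_def W_def)
  moreover have "length v = n" by (simp add: v_def)
  ultimately have "drop (length a + d) w = v @ drop (length a + d + length v) w"
    using dn lW append_take_drop_id[of n "drop d W"]
    unfolding w W_def[symmetric] by (simp add: add.commute)
  with v d show ?thesis unfolding occurs_at_def
    by (auto intro!: exI[of _ "length a + d"])
qed

text \<open>
  Even codes are shifts to the right and odd codes shifts to the left, which removes the integers from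
  \<^const>\<open>occurs_at\<close>.
\<close>

lemma int_decode_shift_iff:
  "int q = int p + int_decode m \<longleftrightarrow>
    (\<exists>a<Suc m. m = a + a \<and> q = p + a) \<or> (\<exists>b<m. m = Suc (b + b) \<and> p = Suc (q + b))"
proof -
  obtain i where i: "m = int_encode i" by (metis int_decode_inverse)
  have parity: "a + a \<noteq> Suc (b + b)" "Suc (b + b) \<noteq> a + a" "a + a = b + b \<longleftrightarrow> a = b" for a b :: nat
    by presburger+
  show ?thesis
  proof (cases "0 \<le> i")
    case True
    then obtain a where "i = int a" using nonneg_int_cases by blast
    with i have "m = a + a" "int_decode m = int a"
      by (simp_all only: int_encode_inverse) (simp add: int_encode_def sum_encode_def)
    then show ?thesis by (auto simp: parity)
  next
    case False
    define b where "b = nat (- i - 1)"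
    have "i = - int (Suc b)" using False by (simp add: b_def)
    with i have "m = Suc (b + b)" "int_decode m = - int (Suc b)"
      by (simp_all only: int_encode_inverse) (simp add: int_encode_def sum_encode_def)
    then show ?thesis by (auto simp: parity)
  qed
qed

lemma recursive_pred_occurs_at [recursive_intros]:
  assumes "recursive_fun a" "recursive_list f" "recursive_fun b"
  shows "recursive_pred (\<lambda>x. occurs_at (pres_decode (a x)) (f x) (b x))"
proof -
  have "recursive_pred (\<lambda>z. \<exists>q<Suc (psnd (psnd z) + pfst (pfst z)).
      ((\<exists>a<Suc (pfst (pfst z)). pfst (pfst z) = a + a \<and> q = psnd (psnd z) + a) \<or>
       (\<exists>b<pfst (pfst z). pfst (pfst z) = Suc (b + b) \<and> psnd (psnd z) = Suc (q + b))) \<and>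
      (\<exists>v\<in>set (list_decode (psnd (psnd (pfst z)))).
        drop q (list_decode (pfst (psnd z))) =
        list_decode v @ drop (q + length (list_decode v)) (list_decode (pfst (psnd z)))))"
    by (intro recursive_intros)
  moreover have "occurs_at (pres_decode c) w p \<longleftrightarrow> (\<exists>q<Suc (p + pfst c).
      ((\<exists>a<Suc (pfst c). pfst c = a + a \<and> q = p + a) \<or> (\<exists>b<pfst c. pfst c = Suc (b + b) \<and> p = Suc (q + b))) \<and>
      (\<exists>v\<in>set (list_decode (psnd (psnd c))). drop q w = list_decode v @ drop (q + length (list_decode v)) w))"
    (is "_ \<longleftrightarrow> (\<exists>q<_. ?shift q \<and> ?match q)") for c w p
  proof -
    have "occurs_at (pres_decode c) w p \<longleftrightarrow> (\<exists>q. ?shift q \<and> ?match q)"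
      by (simp only: occurs_at_def pres_decode_def case_prod_conv int_decode_shift_iff set_map bex_simps)
    moreover have "q < Suc (p + pfst c)" if "?shift q" for q using that by auto
    ultimately show ?thesis by blast
  qed
  ultimately have "recursive_pred (\<lambda>z. occurs_at (pres_decode (pfst z)) (list_decode (pfst (psnd z))) (psnd (psnd z)))"
    by simp
  moreover have "recursive_fun (\<lambda>x. prod_encode (a x, prod_encode (list_encode (f x), b x)))"
    by (intro recursive_intros assms)
  ultimately show ?thesis by (auto dest: recursive_pred_comp)
qed

text \<open>
  The witness \<open>m\<close> codes a stage \<open>N\<close> of the tower, the position \<open>p\<close> of the origin in \<open>T N\<close> and the
  number \<open>j\<close> of steps.
\<close>

definition halting_witness :: "nat \<Rightarrow> (nat \<Rightarrow> nat list) \<Rightarrow> nat set \<Rightarrow> nat \<Rightarrow> nat \<Rightarrow> bool" where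
  "halting_witness h u S z m \<longleftrightarrow>
    valid_pres S (pres_decode (pfst z)) \<and> valid_pres S (pres_decode (pfst (psnd z))) \<and>
    valid_pres S (pres_decode (psnd (psnd z))) \<and>
    occurs_at (pres_decode (pfst z)) (tower h u (pfst m)) (pfst (psnd m)) \<and>
    occurs_at (pres_decode (pfst (psnd z))) (tower h u (pfst m)) (pfst (psnd m) + psnd (psnd m)) \<and>
    (\<forall>i<psnd (psnd m). i = 0 \<or>
      occurs_at (pres_decode (psnd (psnd z))) (tower h u (pfst m)) (pfst (psnd m) + i))"

lemma recursive_rel_halting_witness:
  assumes "recursive_list u" "finite S"
  shows "recursive_rel (halting_witness h u S)"
  unfolding recursive_rel_iff halting_witness_def by (intro recursive_intros assms)

context word_tower
begin

text \<open>
  The orbit segment from \<open>x\<close> to its \<open>j\<close>-th shift is tested on finitely many coordinates, and the window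
  comprising them occurs in some \<open>T N\<close>. Conversely, \<open>T N\<close> is a window of the point \<open>centre\<close>.
\<close>

lemma halts_along_tower_iff:
  assumes c: "valid_pres (insert h S) c" and d: "valid_pres (insert h S) d" and e: "valid_pres (insert h S) e"
  shows "halts_along X (clopen_of c) (clopen_of d) (clopen_of e) \<longleftrightarrow>
    (\<exists>N p j. occurs_at c (T N) p \<and> occurs_at d (T N) (p + j) \<and>
      (\<forall>i<j. i = 0 \<or> occurs_at e (T N) (p + i)))"
proof
  assume "halts_along X (clopen_of c) (clopen_of d) (clopen_of e)"
  then obtain x j where x: "x \<in> X" "x \<in> clopen_of c" "(shift_map ^^ j) x \<in> clopen_of d"
    "\<And>i. 1 \<le> i \<Longrightarrow> i < j \<Longrightarrow> (shift_map ^^ i) x \<in> clopen_of e"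
    unfolding halts_along_def by blast
  have shift: "(shift_map ^^ i) x = (\<lambda>l. x (l + int i))" for i
    by (rule ext) (rule shift_map_power)
  obtain kc nc wc kd nd wd ke n\<^sub>e we where eqs: "c = (kc, nc, wc)" "d = (kd, nd, wd)" "e = (ke, n\<^sub>e, we)"
    by (cases c; cases d; cases e)
  define m where "m = nat \<bar>kc\<bar> + nc + (nat \<bar>kd\<bar> + nd) + (nat \<bar>ke\<bar> + n\<^sub>e) + j"
  obtain N where "sublist (window x (- int m) (2 * m + 1)) (T N)"
    using x(1) by (auto simp: tower_shift_def)
  then obtain a b where N: "T N = a @ window x (- int m) (2 * m + 1) @ b" by (auto simp: sublist_def)
  have "occurs_at c (T N) (length a + m + 0)"
    unfolding eqs by (rule occurs_atI[OF N]) (use x(2) in \<open>simp_all add: eqs m_def\<close>)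
  moreover have "occurs_at d (T N) (length a + m + j)"
    unfolding eqs by (rule occurs_atI[OF N]) (use x(3) in \<open>simp_all add: eqs m_def shift\<close>)
  moreover have "occurs_at e (T N) (length a + m + i)" if "i < j" "i \<noteq> 0" for i
    unfolding eqs by (rule occurs_atI[OF N]) (use x(4)[of i] that in \<open>simp_all add: eqs m_def shift\<close>)
  ultimately show "\<exists>N p j. occurs_at c (T N) p \<and> occurs_at d (T N) (p + j) \<and>
      (\<forall>i<j. i = 0 \<or> occurs_at e (T N) (p + i))"
    by (metis add.right_neutral)
next
  assume "\<exists>N p j. occurs_at c (T N) p \<and> occurs_at d (T N) (p + j) \<and>
      (\<forall>i<j. i = 0 \<or> occurs_at e (T N) (p + i))"
  then obtain N p j where occ: "occurs_at c (T N) p" "occurs_at d (T N) (p + j)"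
    "\<And>i. i < j \<Longrightarrow> i \<noteq> 0 \<Longrightarrow> occurs_at e (T N) (p + i)" by blast
  define x where "x = (\<lambda>i. centre (i + (- int (radius N) + int p)))"
  have shift: "(shift_map ^^ i) x = (\<lambda>l. centre (l + (- int (radius N) + int (p + i))))" for i
    by (rule ext) (simp add: shift_map_power x_def algebra_simps)
  have "x \<in> X" unfolding x_def by (rule subshift_translate[OF subshift_tower centre_in])
  moreover have "x \<in> clopen_of c"
    using occurs_atD[OF occ(1) c window_centre] by (simp add: x_def)
  moreover have "(shift_map ^^ j) x \<in> clopen_of d"
    using occurs_atD[OF occ(2) d window_centre] by (simp only: shift)
  moreover have "(shift_map ^^ i) x \<in> clopen_of e" if "1 \<le> i" "i < j" for i
    using occurs_atD[OF occ(3) e window_centre] that by (simp only: shift)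
  ultimately show "halts_along X (clopen_of c) (clopen_of d) (clopen_of e)"
    unfolding halts_along_def by blast
qed

end

lemma Sigma1_halting_problem_tower:
  assumes "word_tower S Y h u" "recursive_list u"
  shows "Sigma1 (halting_problem (insert h S) (tower_shift h u))"
proof -
  interpret word_tower S Y h u by fact
  have fin: "finite (insert h S)" using Y by (simp add: subshift_def)
  have "z \<in> halting_problem (insert h S) X \<longleftrightarrow> (\<exists>m. halting_witness h u (insert h S) z m)" for z
  proof -
    have "(\<exists>m. halting_witness h u (insert h S) z m) \<longleftrightarrow>
      (\<exists>N p j. halting_witness h u (insert h S) z (prod_encode (N, prod_encode (p, j))))"
      by (metis prod_decode_inverse prod.collapse)
    also have "\<dots> \<longleftrightarrow> z \<in> halting_problem (insert h S) X"
    proof (cases "valid_pres (insert h S) (pres_decode (pfst z)) \<and>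
        valid_pres (insert h S) (pres_decode (pfst (psnd z))) \<and>
        valid_pres (insert h S) (pres_decode (psnd (psnd z)))")
      case True
      then show ?thesis
        by (simp only: halting_problem_iff halting_witness_def halts_along_tower_iff
            prod_encode_inverse fst_conv snd_conv simp_thms)
    next
      case False
      then show ?thesis unfolding halting_problem_iff halting_witness_def by blast
    qed
    finally show ?thesis by simp
  qed
  then show ?thesis unfolding Sigma1_def
    using recursive_rel_halting_witness[OF assms(2) fin] by blast
qed

section \<open>Coding a recursively enumerable set into the gaps\<close>

text \<open>
  A choice of one word of each length that is computable when the language is recursive.
\<close>

definition least_word :: "(int \<Rightarrow> nat) set \<Rightarrow> nat \<Rightarrow> nat list" where
  "least_word Y l = list_decode (LEAST c. list_decode c \<in> language Y \<and> length (list_decode c) = l)"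

lemma least_word:
  assumes "Y \<noteq> {}"
  shows "least_word Y l \<in> language Y" "length (least_word Y l) = l"
proof -
  obtain y where "y \<in> Y" using assms by blast
  then have "window y 0 l \<in> language Y \<and> length (window y 0 l) = l"
    by (simp add: window_in_language)
  then have "\<exists>c. list_decode c \<in> language Y \<and> length (list_decode c) = l"
    by (metis list_encode_inverse)
  from LeastI_ex[OF this] show "least_word Y l \<in> language Y" "length (least_word Y l) = l"
    by (simp_all add: least_word_def)
qed

lemma recursive_list_least_word:
  assumes rec: "recursive_set (list_encode ` language Y)" and ne: "Y \<noteq> {}" and a: "recursive_fun a"
  shows "recursive_list (\<lambda>x. least_word Y (a x))"
proof -
  have "c \<in> list_encode ` language Y \<longleftrightarrow> list_decode c \<in> language Y" for c
    by (metis image_iff list_decode_inverse list_encode_inverse)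
  then have "recursive_pred (\<lambda>c. list_decode c \<in> language Y)"
    using rec by (simp add: recursive_set_iff)
  then have "recursive_pred (\<lambda>z. list_decode (pfst z) \<in> language Y)"
    by (rule recursive_pred_comp) (intro recursive_intros)
  then have "recursive_list (\<lambda>l. least_word Y l)"
    unfolding least_word_def
  proof (intro recursive_intros recursive_fun_Least_pred)
    show "\<exists>c. list_decode c \<in> language Y \<and> length (list_decode c) = l" for l
      by (intro exI[of _ "list_encode (least_word Y l)"]) (simp add: least_word[OF ne])
  qed
  then show ?thesis by (rule recursive_list_comp[OF _ a])
qed

text \<open>
  Odd lengths enumerate \<open>{e. \<exists>m. R e m}\<close>: the length \<open>2 * e + 1\<close> appears once a witness for \<open>e\<close> is
  met. In both cases the value is at least twice the first component of \<open>n\<close>, so the lengths are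
  unbounded whatever \<open>R\<close> is.
\<close>

definition gap_length :: "(nat \<Rightarrow> nat \<Rightarrow> bool) \<Rightarrow> nat \<Rightarrow> nat" where
  "gap_length R n = (if R (pfst n) (psnd n) then Suc (pfst n + pfst n) else n + n)"

lemma recursive_fun_gap_length: "recursive_rel R \<Longrightarrow> recursive_fun (gap_length R)"
  unfolding recursive_rel_iff gap_length_def[abs_def] by (intro recursive_intros)

lemma gap_length_unbounded: "\<exists>n. b \<le> gap_length R n"
  by (rule exI[of _ "prod_encode (b, 0)"])
     (use le_prod_encode_1[of b 0] in \<open>simp add: gap_length_def\<close>)

lemma odd_gap_length_iff: "(\<exists>n. gap_length R n = Suc (e + e)) \<longleftrightarrow> (\<exists>m. R e m)"
proof
  assume "\<exists>n. gap_length R n = Suc (e + e)"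
  then obtain n where n: "gap_length R n = Suc (e + e)" ..
  have "n + n \<noteq> Suc (e + e)" by presburger
  with n have "R (pfst n) (psnd n)" "pfst n = e" by (auto simp: gap_length_def split: if_splits)
  then show "\<exists>m. R e m" by blast
next
  assume "\<exists>m. R e m"
  then obtain m where "R e m" ..
  then show "\<exists>n. gap_length R n = Suc (e + e)"
    by (intro exI[of _ "prod_encode (e, m)"]) (simp add: gap_length_def)
qed

lemma sublist_gap_list: "n \<in> set ks \<Longrightarrow> sublist (h # u n @ [h]) (gap_list h u ks)"
proof (induction ks)
  case (Cons k ks)
  show ?case
  proof (cases "n = k")
    case True
    obtain v where "gap_list h u ks = h # v" by (simp add: gap_list_def)
    then have "gap_list h u (k # ks) = [] @ (h # u n @ [h]) @ v" using True by (simp add: gap_list_simps)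
    then show ?thesis unfolding sublist_def by blast
  next
    case False
    with Cons have "sublist (h # u n @ [h]) (gap_list h u ks)" by simp
    then have "sublist (h # u n @ [h]) ((h # u k) @ gap_list h u ks)" by (rule sublist_order.order_trans) (rule sublist_append_leftI)
    then show ?thesis by (simp add: gap_list_simps)
  qed
qed simp

context word_tower
begin

lemma gap_in_language_iff:
  assumes "h \<notin> set v"
  shows "h # v @ [h] \<in> language X \<longleftrightarrow> (\<exists>n. u n = v)"
proof
  assume "h # v @ [h] \<in> language X"
  then obtain N where "sublist (h # v @ [h]) (T N)" using language_tower_shift by blast
  moreover obtain ks where "T N = gap_list h u ks" using tower_eq_gap_list[of h u N] by blast
  ultimately obtain ps ss where "gap_list h u ks = ps @ h # v @ h # ss" by (auto simp: sublist_def)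
  from gap_list_gapD[OF this assms gap_avoids] show "\<exists>n. u n = v" by blast
next
  assume "\<exists>n. u n = v"
  then obtain n where n: "u n = v" ..
  obtain ks where ks: "T n = gap_list h u ks" using tower_eq_gap_list[of h u n] by blast
  have "T (Suc n) = gap_list h u (ks @ n # ks @ n # ks)" by (simp add: ks gap_list_append)
  then have "sublist (h # v @ [h]) (T (Suc n))" using sublist_gap_list[of n _ h u] n by simp
  then show "h # v @ [h] \<in> language X" using language_tower_shift by blast
qed

end

text \<open>
  With zero steps and the whole space as target, the halting problem asks whether a word occurs.
\<close>

lemma halts_along_cylinder:
  assumes "subshift S X"
  shows "halts_along X (clopen_of (0, length w, [w])) (clopen_of (0, 0, [[]])) E \<longleftrightarrow> w \<in> language X"
proof
  assume "halts_along X (clopen_of (0, length w, [w])) (clopen_of (0, 0, [[]])) E"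
  then show "w \<in> language X" by (auto simp: halts_along_def clopen_of_def in_language_iff)
next
  assume "w \<in> language X"
  then obtain x k where "x \<in> X" "window x k (length w) = w" by (auto simp: in_language_iff)
  then have "(\<lambda>i. x (i + k)) \<in> X" "(\<lambda>i. x (i + k)) \<in> clopen_of (0, length w, [w])"
    using subshift_translate[OF assms] by (simp_all add: clopen_of_def window_translate)
  moreover have "(shift_map ^^ 0) (\<lambda>i. x (i + k)) \<in> clopen_of (0, 0, [[]])"
    by (simp add: clopen_of_def window_def)
  ultimately show "halts_along X (clopen_of (0, length w, [w])) (clopen_of (0, 0, [[]])) E"
    unfolding halts_along_def by (metis less_nat_zero_code)
qed

theorem theorem3:
  fixes S :: "nat set" and Y :: "(int \<Rightarrow> nat) set"
  assumes "subshift S Y" and "recursive_subshift S Y" and "infinite Y" and "minimal_subshift S Y"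
  shows "\<exists>S' X. subshift S' X \<and> transitive_subshift S' X \<and> uncountable X \<and>
    quasiminimal_subshift S' X \<and>
    Sigma1_complete (halting_problem S' X) \<and>
    {Z. nontrivial_subsystem S' Z X} = {Y}"
proof -
  have ne: "Y \<noteq> {}" using assms(3) by auto
  have rec: "recursive_set (list_encode ` language Y)"
    using assms(2) by (simp add: recursive_subshift_def)
  obtain h where fresh: "h \<notin> S"
    using assms(1) ex_new_if_finite[OF infinite_UNIV_nat] unfolding subshift_def by blast
  define u where "u n = least_word Y (gap_length universal_rel n)" for n
  have word_tower: "word_tower S Y h u"
    by unfold_locales
       (use assms(4) ne fresh gap_length_unbounded in \<open>simp_all add: u_def least_word\<close>)
  then interpret word_tower S Y h u .
  have "recursive_list u"
    unfolding u_def[abs_def]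
    by (intro recursive_list_least_word[OF rec ne] recursive_fun_gap_length recursive_rel_universal_rel)
  with word_tower have Sigma1: "Sigma1 (halting_problem (insert h S) X)"
    by (rule Sigma1_halting_problem_tower)

  \<comment> \<open>the word that occurs in \<open>X\<close> exactly if \<open>e\<close> is enumerated, and the instance asking for it\<close>
  define marked where "marked e = h # least_word Y (Suc (e + e)) @ [h]" for e
  define instance_of where "instance_of e = prod_encode (pres_encode (0, length (marked e), [marked e]),
    prod_encode (pres_encode (0, 0, [[]]), pres_encode (0, 0, [[]])))" for e
  have least_word_letters: "set (least_word Y l) \<subseteq> S" for l
    by (rule language_letters[OF Y least_word(1)[OF ne]])
  have marked_iff: "marked e \<in> language X \<longleftrightarrow> (\<exists>w. universal_rel e w)" for e
  proof -
    have "marked e \<in> language X \<longleftrightarrow> (\<exists>n. u n = least_word Y (Suc (e + e)))"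
      unfolding marked_def using least_word_letters fresh by (intro gap_in_language_iff) blast
    also have "\<dots> \<longleftrightarrow> (\<exists>n. gap_length universal_rel n = Suc (e + e))"
      unfolding u_def by (metis least_word(2)[OF ne])
    finally show ?thesis by (simp only: odd_gap_length_iff)
  qed
  have reduces: "instance_of e \<in> halting_problem (insert h S) X \<longleftrightarrow> (\<exists>w. universal_rel e w)" for e
  proof -
    have "valid_pres (insert h S) (0, length (marked e), [marked e])" "valid_pres (insert h S) (0, 0, [[]])"
      using least_word_letters by (auto simp: valid_pres_def marked_def)
    then show ?thesis
      unfolding instance_of_def halting_problem_iff marked_iff[symmetric]
      by (simp add: halts_along_cylinder[OF subshift_tower])
  qed
  have marked: "recursive_list marked"
    unfolding marked_def[abs_def] by (intro recursive_intros recursive_list_least_word[OF rec ne])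
  have instance_rec: "recursive_fun instance_of"
    unfolding instance_of_def[abs_def] pres_encode_def case_prod_conv list.map
    by (intro recursive_intros marked)
  have "many_one_reducible A (halting_problem (insert h S) X)" if A: "Sigma1 A" for A
  proof -
    obtain f where f: "recursive_fun f" "\<And>n. n \<in> A \<longleftrightarrow> f n \<in> {e. \<exists>w. universal_rel e w}"
      using Sigma1_reducible_universal[OF A] unfolding many_one_reducible_def by blast
    have "recursive_fun (\<lambda>n. instance_of (f n))" by (rule recursive_fun_comp[OF instance_rec f(1)])
    moreover have "n \<in> A \<longleftrightarrow> instance_of (f n) \<in> halting_problem (insert h S) X" for n
      unfolding f(2) reduces by simp
    ultimately show ?thesis unfolding many_one_reducible_def by blast
  qed
  with Sigma1 have "Sigma1_complete (halting_problem (insert h S) X)"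
    by (simp add: Sigma1_complete_def)
  then show ?thesis
    using subshift_tower transitive_tower uncountable_tower quasiminimal_tower nontrivial_subsystems
    by blast
qed

end
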